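(* Let $G=(V,E)$ be a directed graph with $n$ nodes and $m$ edges, let $t\in V$ be a target node, let $\alpha\in(0,1)$ be a constant teleport probability, and let $\varepsilon\in(0,1)$ be an additive error parameter. Run Randomized Backward Search (RBS, defined in the context) with sampling function $\lambda(u)=\sqrt{d_{out}(u)}$ and error parameter $\theta=\tilde{O}(\varepsilon)$. Then with high probability the output satisfies $|\hat{\pi}(s,t)-\pi(s,t)|\le\varepsilon$ for all $s\in V$. Here $\theta$ equals $\varepsilon$ up to a factor polylogarithmic in $n$ and $1/\varepsilon$, and the success probability may be amplified by running $O(\log n)$ independent copies of the algorithm and taking, for each node, the median of the estimates; these overheads are absorbed in the $\tilde O$ notation. The expected worst-case time cost is $$\mathrm{E}[\mathrm{Cost}]=\tilde{O}\!\left(\frac{1}{\varepsilon}\sum_{u\in V}\sqrt{d_{out}(u)}\,\pi(u,t)\right).$$ If the target node $t$ is chosen uniformly at random from $V$, the expected time cost is $\tilde{O}\!\left(\frac{\sqrt{\bar d}}{\varepsilon}\right)$, where $\bar d=m/n$ is the average degree.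
   Context: $G=(V,E)$ is a directed graph with $n=|V|$, $m=|E|$; $N_{in}(v)$, $N_{out}(u)$ are the in-/out-neighbor sets and $d_{in}(v)$, $d_{out}(u)$ the in-/out-degrees. An $\alpha$-discounted random walk from $s$: at each step it terminates at the current node with probability $\alpha$, and otherwise moves to a uniformly random out-neighbor of the current node. The Personalized PageRank $\pi(s,t)$ is the probability that such a walk from $s$ terminates at $t$; the $\ell$-hop PPR $\pi_\ell(s,t)$ is the probability that it terminates at $t$ after exactly $\ell$ steps, so $\pi(s,t)=\sum_{\ell\ge0}\pi_\ell(s,t)$. $\tilde O$ denotes big-O ignoring logarithmic factors. Randomized Backward Search (RBS), with inputs $G$, target $t$, $\alpha$, error parameter $\theta\in(0,1)$, and sampling function $\lambda:V\to(0,\infty)$: Set $L=\log_{1-\alpha}\theta$. Set $\hat\pi_\ell(s,t)=0$ for all $s\in V$ and $\ell=0,\dots,L$, except $\hat\pi_0(t,t)=\alpha$. For $\ell=0,\dots,L-1$, for each $v\in V$ with $\hat\pi_\ell(v,t)\neq0$: (i) for each $u\in N_{in}(v)$ with $d_{out}(u)\le \frac{\lambda(u)(1-\alpha)\hat\pi_\ell(v,t)}{\alpha\theta}$, add $\frac{(1-\alpha)\hat\pi_\ell(v,t)}{d_{out}(u)}$ to $\hat\pi_{\ell+1}(u,t)$; (ii) draw $r$ uniformly from $(0,1)$, independently of all other draws, and for each $u\in N_{in}(v)$ with $\frac{\lambda(u)(1-\alpha)\hat\pi_\ell(v,t)}{\alpha\theta}<d_{out}(u)\le\frac{\lambda(u)(1-\alpha)\hat\pi_\ell(v,t)}{r\,\alpha\theta}$,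 add $\frac{\alpha\theta}{\lambda(u)}$ to $\hat\pi_{\ell+1}(u,t)$. Output $\hat\pi(s,t)=\sum_{\ell=0}^{L}\hat\pi_\ell(s,t)$ for each $s\in V$. In-adjacency lists are pre-sorted by out-degree so each loop scans only the neighbors it updates; the time cost is the number of such update operations. *)

theory Defs
  imports "HOL-Probability.Probability" "Graph_Theory.Pair_Digraph"
begin

section \<open>Personalized PageRank\<close>

definition out_nbrs :: "'a pair_pre_digraph \<Rightarrow> 'a \<Rightarrow> 'a set" where
  "out_nbrs G u = {v. (u, v) \<in> parcs G}"

definition in_nbrs :: "'a pair_pre_digraph \<Rightarrow> 'a \<Rightarrow> 'a set" where
  "in_nbrs G v = {u. (u, v) \<in> parcs G}"

text \<open>
  The \<open>\<alpha>\<close>-discounted random walk from \<open>s\<close>, as the joint subdistribution of the node at which it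
  terminates and the number of moves made before. If a node without out-neighbors is reached and
  the walk does not terminate there, there is no node to move to and the walk is lost:
  \<^term>\<open>spmf_of_set {}\<close> is the zero subdistribution.
\<close>

partial_function (spmf) discounted_walk ::
    "'a pair_pre_digraph \<Rightarrow> real \<Rightarrow> 'a \<Rightarrow> ('a \<times> nat) spmf" where
  "discounted_walk G \<alpha> s =
     bind_pmf (bernoulli_pmf \<alpha>) (\<lambda>stop.
       if stop then return_spmf (s, 0)
       else bind_spmf (spmf_of_set (out_nbrs G s)) (\<lambda>u.
              map_spmf (\<lambda>(v, l). (v, Suc l)) (discounted_walk G \<alpha> u)))"

definition ppr :: "'a pair_pre_digraph \<Rightarrow> real \<Rightarrow> 'a \<Rightarrow> 'a \<Rightarrow> real" where
  "ppr G \<alpha> s t = spmf (map_spmf fst (discounted_walk G \<alpha> s)) t"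

definition hop_ppr :: "'a pair_pre_digraph \<Rightarrow> real \<Rightarrow> nat \<Rightarrow> 'a \<Rightarrow> 'a \<Rightarrow> real" where
  "hop_ppr G \<alpha> l s t = spmf (discounted_walk G \<alpha> s) (t, l)"

lemma ppr_sums_hop_ppr: "(\<lambda>l. hop_ppr G \<alpha> l s t) sums ppr G \<alpha> s t"
proof -
  let ?p = "discounted_walk G \<alpha> s"
  let ?M = "measure_spmf ?p"
  have "(\<lambda>l. measure ?M {(t, l)}) sums measure ?M (\<Union>l. {(t, l)})"
    by (rule measure_spmf.finite_measure_UNION) (auto simp: disjoint_family_on_def)
  also have "(\<Union>l. {(t, l)}) = fst -` {t}"
    by auto
  finally show ?thesis
    by (simp add: hop_ppr_def ppr_def spmf_conv_measure_spmf measure_map_spmf)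
qed


section \<open>Randomized Backward Search\<close>

text \<open>
  The draws are passed in as \<open>r\<close>: the number \<open>r l v\<close> is the one used when \<open>v\<close> is processed at
  level \<open>l\<close>. Processing level \<open>l\<close> only reads level \<open>l\<close> and only writes level \<open>l + 1\<close>, so the order of
  the updates is irrelevant and the values accumulated at level \<open>l + 1\<close> are sums. The function
  \<open>lam\<close> is evaluated only at nodes having an out-neighbor.
\<close>

definition rbs_threshold ::
    "real \<Rightarrow> real \<Rightarrow> ('a \<Rightarrow> real) \<Rightarrow> real \<Rightarrow> 'a \<Rightarrow> real" where
  "rbs_threshold \<alpha> \<theta> lam x u = lam u * (1 - \<alpha>) * x / (\<alpha> * \<theta>)"

text \<open>
  The nodes updated deterministically and at random while processing a node \<open>v\<close> whose current
  estimate is \<open>x\<close>, with draw \<open>r\<close>.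
\<close>

definition det_updates ::
    "'a pair_pre_digraph \<Rightarrow> real \<Rightarrow> real \<Rightarrow> ('a \<Rightarrow> real) \<Rightarrow> real \<Rightarrow> 'a \<Rightarrow> 'a set" where
  "det_updates G \<alpha> \<theta> lam x v =
     {u \<in> in_nbrs G v. real (out_degree G u) \<le> rbs_threshold \<alpha> \<theta> lam x u}"

definition rand_updates ::
    "'a pair_pre_digraph \<Rightarrow> real \<Rightarrow> real \<Rightarrow> ('a \<Rightarrow> real) \<Rightarrow> real \<Rightarrow> real \<Rightarrow> 'a \<Rightarrow> 'a set" where
  "rand_updates G \<alpha> \<theta> lam r x v =
     {u \<in> in_nbrs G v. rbs_threshold \<alpha> \<theta> lam x u < real (out_degree G u)
        \<and> real (out_degree G u) \<le> rbs_threshold \<alpha> \<theta> lam x u / r}"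

fun rbs_level ::
    "'a pair_pre_digraph \<Rightarrow> 'a \<Rightarrow> real \<Rightarrow> real \<Rightarrow> ('a \<Rightarrow> real) \<Rightarrow> (nat \<Rightarrow> 'a \<Rightarrow> real)
       \<Rightarrow> nat \<Rightarrow> 'a \<Rightarrow> real" where
  "rbs_level G t \<alpha> \<theta> lam r 0 u = (if u = t then \<alpha> else 0)"
| "rbs_level G t \<alpha> \<theta> lam r (Suc l) u =
     (\<Sum>v | v \<in> pverts G \<and> rbs_level G t \<alpha> \<theta> lam r l v \<noteq> 0.
        (if u \<in> det_updates G \<alpha> \<theta> lam (rbs_level G t \<alpha> \<theta> lam r l v) v
         then (1 - \<alpha>) * rbs_level G t \<alpha> \<theta> lam r l v / real (out_degree G u) else 0)
      + (if u \<in> rand_updates G \<alpha> \<theta> lam (r l v) (rbs_level G t \<alpha> \<theta> lam r l v) v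
         then \<alpha> * \<theta> / lam u else 0))"

text \<open>The number of levels; the levels \<open>l\<close> in question are the integers \<open>0 \<le> l \<le> log\<^bsub>1-\<alpha>\<^esub> \<theta>\<close>.\<close>

definition rbs_depth :: "real \<Rightarrow> real \<Rightarrow> nat" where
  "rbs_depth \<alpha> \<theta> = nat \<lfloor>log (1 - \<alpha>) \<theta>\<rfloor>"

definition rbs ::
    "'a pair_pre_digraph \<Rightarrow> 'a \<Rightarrow> real \<Rightarrow> real \<Rightarrow> ('a \<Rightarrow> real) \<Rightarrow> (nat \<Rightarrow> 'a \<Rightarrow> real)
       \<Rightarrow> 'a \<Rightarrow> real" where
  "rbs G t \<alpha> \<theta> lam r s = (\<Sum>l\<le>rbs_depth \<alpha> \<theta>. rbs_level G t \<alpha> \<theta> lam r l s)"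

definition rbs_cost ::
    "'a pair_pre_digraph \<Rightarrow> 'a \<Rightarrow> real \<Rightarrow> real \<Rightarrow> ('a \<Rightarrow> real) \<Rightarrow> (nat \<Rightarrow> 'a \<Rightarrow> real) \<Rightarrow> nat" where
  "rbs_cost G t \<alpha> \<theta> lam r =
     (\<Sum>l<rbs_depth \<alpha> \<theta>. \<Sum>v | v \<in> pverts G \<and> rbs_level G t \<alpha> \<theta> lam r l v \<noteq> 0.
        card (det_updates G \<alpha> \<theta> lam (rbs_level G t \<alpha> \<theta> lam r l v) v)
      + card (rand_updates G \<alpha> \<theta> lam (r l v) (rbs_level G t \<alpha> \<theta> lam r l v) v))"


section \<open>Independent copies\<close>

text \<open>Independent uniform draws from \<open>(0,1)\<close>, indexed by copy, level and node.\<close>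

definition rbs_draws ::
    "'a pair_pre_digraph \<Rightarrow> real \<Rightarrow> real \<Rightarrow> nat \<Rightarrow> (nat \<times> nat \<times> 'a \<Rightarrow> real) measure" where
  "rbs_draws G \<alpha> \<theta> K =
     (\<Pi>\<^sub>M i \<in> {..<K} \<times> {..<rbs_depth \<alpha> \<theta>} \<times> pverts G. uniform_measure lborel {0<..<1})"

definition median :: "real list \<Rightarrow> real" where
  "median xs = (sort xs ! ((length xs - 1) div 2) + sort xs ! (length xs div 2)) / 2"

definition median_rbs ::
    "'a pair_pre_digraph \<Rightarrow> 'a \<Rightarrow> real \<Rightarrow> real \<Rightarrow> ('a \<Rightarrow> real) \<Rightarrow> nat
       \<Rightarrow> (nat \<times> nat \<times> 'a \<Rightarrow> real) \<Rightarrow> 'a \<Rightarrow> real" where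
  "median_rbs G t \<alpha> \<theta> lam K \<omega> s =
     median (map (\<lambda>i. rbs G t \<alpha> \<theta> lam (\<lambda>l v. \<omega> (i, l, v)) s) [0..<K])"

definition median_rbs_cost ::
    "'a pair_pre_digraph \<Rightarrow> 'a \<Rightarrow> real \<Rightarrow> real \<Rightarrow> ('a \<Rightarrow> real) \<Rightarrow> nat
       \<Rightarrow> (nat \<times> nat \<times> 'a \<Rightarrow> real) \<Rightarrow> nat" where
  "median_rbs_cost G t \<alpha> \<theta> lam K \<omega> =
     (\<Sum>i<K. rbs_cost G t \<alpha> \<theta> lam (\<lambda>l v. \<omega> (i, l, v)))"

definition expected_cost ::
    "'a pair_pre_digraph \<Rightarrow> 'a \<Rightarrow> real \<Rightarrow> real \<Rightarrow> ('a \<Rightarrow> real) \<Rightarrow> nat \<Rightarrow> real" where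
  "expected_cost G t \<alpha> \<theta> lam K =
     (\<integral>\<omega>. real (median_rbs_cost G t \<alpha> \<theta> lam K \<omega>) \<partial>rbs_draws G \<alpha> \<theta> K)"

definition sqrt_degree :: "'a pair_pre_digraph \<Rightarrow> 'a \<Rightarrow> real" where
  "sqrt_degree G u = sqrt (real (out_degree G u))"

text \<open>
  The factors hidden in a soft-O are bounded by \<open>C * polylog k n \<epsilon>\<close> for constants \<open>C\<close> and \<open>k\<close>.
  The summand 1 keeps the factor at least 1 when \<open>n\<close> and \<open>1/\<epsilon>\<close> are close to 1.
\<close>

definition polylog :: "nat \<Rightarrow> nat \<Rightarrow> real \<Rightarrow> real" where
  "polylog k n \<epsilon> = (1 + ln (real n) + ln (1 / \<epsilon>)) ^ k"

end

theory Submission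
  imports Defs "HOL-Real_Asymp.Real_Asymp"
begin

text \<open>
  Conditionally on the earlier levels, each update is unbiased, so the expected estimate at level
  \<open>l\<close> is the \<open>l\<close>-hop PPR. For a fixed source the conditional expectations of the estimate given the
  draws of the first levels form a martingale. In one of its steps the node \<open>v\<close> contributes a
  random variable whose range has width \<open>a\<^sub>v = \<alpha>\<theta> \<Sum>\<^sub>u w(u) / sqrt (d(u))\<close>, the sum being over the
  in-neighbors \<open>u\<close> of \<open>v\<close>, whose out-degree is \<open>d(u)\<close>, for weights \<open>w\<close> of total mass at most \<open>1/\<alpha>\<close>; by Cauchy--Schwarz
  \<open>\<Sum>\<^sub>v a\<^sub>v\<^sup>2 \<le> \<theta>\<^sup>2\<close>, whatever the current estimates are. Hoeffding's lemma thus makes the estimate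
  subgaussian with variance proxy \<open>\<theta>\<^sup>2\<close> times the logarithmic number of levels, and with
  \<open>\<theta> = \<epsilon> / (B (1 + ln n + ln (1/\<epsilon>)))\<close> a single copy already succeeds with high probability, so
  no median over several copies is needed. For the cost, every single update of \<open>u\<close> counts at most
  \<open>\<lambda>(u) / (\<alpha>\<theta>)\<close> times the amount that it adds to the estimate, and the total of these amounts
  is at most \<open>\<pi>(u,t)\<close> in expectation.
\<close>

section \<open>Personalized PageRank\<close>

lemma sum_spmf_le_1: "finite A \<Longrightarrow> (\<Sum>x\<in>A. spmf p x) \<le> 1"
proof -
  assume "finite A"
  have "(\<Sum>x\<in>A. spmf p x) = (\<Sum>x\<in>Some ` A. pmf p x)"
    by (simp add: sum.reindex)
  also have "\<dots> = measure (measure_pmf p) (Some ` A)"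
    using \<open>finite A\<close> by (simp add: measure_measure_pmf_finite)
  also have "\<dots> \<le> 1"
    by simp
  finally show ?thesis .
qed

text \<open>The discounted transition matrix of the walk: on the vertices,
  \<open>hop_ppr G \<alpha> l\<close> is \<alpha> times its \<open>l\<close>-th power.\<close>

definition ppr_step :: "'a pair_pre_digraph \<Rightarrow> real \<Rightarrow> 'a \<Rightarrow> 'a \<Rightarrow> real" where
  "ppr_step G \<alpha> u v = (if (u, v) \<in> parcs G then (1 - \<alpha>) / real (out_degree G u) else 0)"

lemma out_degree_eq_card_out_nbrs: "out_degree (with_proj G) u = card (out_nbrs G u)"
proof -
  have "out_arcs (with_proj G) u = Pair u ` out_nbrs G u"
    by (auto simp: out_arcs_def out_nbrs_def)
  then show ?thesis
    by (simp add: out_degree_def card_image inj_on_def)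
qed

context pair_fin_digraph
begin

lemma finite_nbrs [simp]: "finite (out_nbrs G u)" "finite (in_nbrs G u)"
  using finite_subset[of "out_nbrs G u" "pverts G"] finite_subset[of "in_nbrs G u" "pverts G"]
    pair_finite_verts wellformed' by (auto simp: out_nbrs_def in_nbrs_def)

lemma out_degree_pos: "(u, v) \<in> parcs G \<Longrightarrow> 0 < out_degree G u"
  unfolding out_degree_eq_card_out_nbrs by (auto simp: card_gt_0_iff) (auto simp: out_nbrs_def)

lemma sum_out_degree: "(\<Sum>u\<in>pverts G. out_degree G u) = card (parcs G)"
proof -
  have "parcs G = Sigma (pverts G) (out_nbrs G)"
    using wellformed' by (auto simp: out_nbrs_def)
  then show ?thesis
    by (simp add: out_degree_eq_card_out_nbrs pair_finite_verts)
qed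

text \<open>Only an inequality, since \<open>A\<close> may miss out-neighbors and the row of a node
  without out-neighbors vanishes.\<close>

lemma sum_ppr_step_le: "(\<Sum>v\<in>A. ppr_step G \<alpha> u v) \<le> 1 - \<alpha>" if "finite A" "\<alpha> \<le> 1"
proof -
  have "(\<Sum>v\<in>A. ppr_step G \<alpha> u v) = (\<Sum>v\<in>A \<inter> out_nbrs G u. (1 - \<alpha>) / real (out_degree G u))"
    using that by (intro sum.mono_neutral_cong_right) (auto simp: ppr_step_def out_nbrs_def)
  also have "\<dots> = real (card (A \<inter> out_nbrs G u)) * ((1 - \<alpha>) / real (out_degree G u))"
    by simp
  also have "\<dots> \<le> real (out_degree G u) * ((1 - \<alpha>) / real (out_degree G u))"
    unfolding out_degree_eq_card_out_nbrs using that
    by (intro mult_right_mono) (auto intro!: card_mono)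
  \<comment> \<open>For out-degree 0 the left-hand side is 0, because division by 0 gives 0.\<close>
  also have "\<dots> \<le> 1 - \<alpha>"
    using that by simp
  finally show ?thesis .
qed

section \<open>Recursions of the hop PPR along the first and the last move\<close>

lemma hop_ppr_0: "hop_ppr G \<alpha> 0 s t = (if s = t then \<alpha> else 0)"
  if "0 < \<alpha>" "\<alpha> < 1"
proof -
  have "hop_ppr G \<alpha> 0 s t = \<alpha> * spmf (return_spmf (s, 0 :: nat)) (t, 0)
    + (1 - \<alpha>) * spmf (bind_spmf (spmf_of_set (out_nbrs G s)) (\<lambda>u.
              map_spmf (\<lambda>(v, l). (v, Suc l)) (discounted_walk G \<alpha> u))) (t, 0 :: nat)"
    unfolding hop_ppr_def using that
    by (subst discounted_walk.simps) (simp add: pmf_bind)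
  also have "spmf (bind_spmf (spmf_of_set (out_nbrs G s)) (\<lambda>u.
              map_spmf (\<lambda>(v, l). (v, Suc l)) (discounted_walk G \<alpha> u))) (t, 0 :: nat) = 0"
    by (auto simp: spmf_eq_0_set_spmf set_bind_spmf)
  finally show ?thesis
    by auto
qed

lemma hop_ppr_Suc:
  "hop_ppr G \<alpha> (Suc l) s t = (\<Sum>v\<in>pverts G. ppr_step G \<alpha> s v * hop_ppr G \<alpha> l v t)"
  if "0 < \<alpha>" "\<alpha> < 1"
proof -
  have *: "spmf (map_spmf (\<lambda>(v, l). (v, Suc l)) p) (t, Suc l) = spmf p (t, l)"
    for p :: "('a \<times> nat) spmf"
    using spmf_map_inj'[of "\<lambda>(v, l). (v, Suc l)" p "(t, l)"] by (auto simp: inj_on_def)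
  have "hop_ppr G \<alpha> (Suc l) s t = \<alpha> * spmf (return_spmf (s, 0)) (t, Suc l)
    + (1 - \<alpha>) * spmf (bind_spmf (spmf_of_set (out_nbrs G s)) (\<lambda>u.
              map_spmf (\<lambda>(v, l). (v, Suc l)) (discounted_walk G \<alpha> u))) (t, Suc l)"
    unfolding hop_ppr_def using that
    by (subst discounted_walk.simps) (simp add: pmf_bind)
  also have "\<dots> = (1 - \<alpha>) * ((\<Sum>v\<in>out_nbrs G s. hop_ppr G \<alpha> l v t) / card (out_nbrs G s))"
    by (simp add: spmf_bind integral_spmf_of_set * hop_ppr_def)
  also have "\<dots> = (\<Sum>v\<in>out_nbrs G s. ppr_step G \<alpha> s v * hop_ppr G \<alpha> l v t)"
    by (simp add: sum_distrib_left sum_divide_distrib ppr_step_def out_degree_eq_card_out_nbrs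
        out_nbrs_def)
  also have "\<dots> = (\<Sum>v\<in>pverts G. ppr_step G \<alpha> s v * hop_ppr G \<alpha> l v t)"
    using wellformed' pair_finite_verts
    by (intro sum.mono_neutral_left) (auto simp: out_nbrs_def ppr_step_def)
  finally show ?thesis .
qed

text \<open>The walk is defined by splitting off its first move; the matrix power can equally be
  split at its last factor. This form keeps the source \<open>s\<close> fixed, as
  \<open>hops_upto_Suc\<close> requires.\<close>

lemma hop_ppr_Suc_last:
  "hop_ppr G \<alpha> (Suc l) s t = (\<Sum>u\<in>pverts G. hop_ppr G \<alpha> l s u * ppr_step G \<alpha> u t)"
  if "0 < \<alpha>" "\<alpha> < 1" "s \<in> pverts G" "t \<in> pverts G"
  using that(3)
proof (induction l arbitrary: s)
  case 0
  then show ?case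
    using that pair_finite_verts by (simp add: hop_ppr_Suc hop_ppr_0 mult_delta_left mult_delta_right mult.commute)
next
  case (Suc l)
  have "hop_ppr G \<alpha> (Suc (Suc l)) s t
      = (\<Sum>v\<in>pverts G. ppr_step G \<alpha> s v * (\<Sum>u\<in>pverts G. hop_ppr G \<alpha> l v u * ppr_step G \<alpha> u t))"
    using that Suc by (subst hop_ppr_Suc) (auto intro!: sum.cong)
  also have "\<dots> = (\<Sum>u\<in>pverts G. (\<Sum>v\<in>pverts G. ppr_step G \<alpha> s v * hop_ppr G \<alpha> l v u) * ppr_step G \<alpha> u t)"
    by (simp add: sum_distrib_left sum_distrib_right mult_ac) (rule sum.swap)
  finally show ?case
    using that by (simp add: hop_ppr_Suc)
qed

section \<open>Mass bounds and truncation error\<close>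

lemma hop_ppr_nonneg [simp]: "0 \<le> hop_ppr G \<alpha> l s t"
  by (simp add: hop_ppr_def)

text \<open>Distinct pairs of end node and number of moves are disjoint outcomes of a single
  walk.\<close>

lemma sum_hop_ppr_le_1:
  assumes "finite A" "finite B" shows "(\<Sum>i\<in>A. \<Sum>u\<in>B. hop_ppr G \<alpha> i s u) \<le> 1"
proof -
  have "(\<Sum>i\<in>A. \<Sum>u\<in>B. hop_ppr G \<alpha> i s u) = (\<Sum>x\<in>B \<times> A. spmf (discounted_walk G \<alpha> s) x)"
    unfolding hop_ppr_def
    by (subst sum.swap) (simp add: sum.cartesian_product)
  also have "\<dots> \<le> 1"
    using assms by (intro sum_spmf_le_1) auto
  finally show ?thesis .
qed

text \<open>A walk makes \<open>l\<close> moves with probability at most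
  \<open>(1 - \<alpha>) ^ l\<close> and then has to stop; the induction is on the first move, using
  the row sums of \<open>ppr_step\<close>.\<close>

lemma hop_ppr_le: "hop_ppr G \<alpha> l s t \<le> \<alpha> * (1 - \<alpha>) ^ l"
  if "0 < \<alpha>" "\<alpha> < 1"
proof (induction l arbitrary: s)
  case 0
  then show ?case using that by (simp add: hop_ppr_0)
next
  case (Suc l)
  have "hop_ppr G \<alpha> (Suc l) s t \<le> (\<Sum>v\<in>pverts G. ppr_step G \<alpha> s v * (\<alpha> * (1 - \<alpha>) ^ l))"
    unfolding hop_ppr_Suc[OF that] using that Suc
    by (intro sum_mono mult_left_mono) (auto simp: ppr_step_def)
  also have "\<dots> \<le> (1 - \<alpha>) * (\<alpha> * (1 - \<alpha>) ^ l)"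
    unfolding sum_distrib_right[symmetric] using that sum_ppr_step_le pair_finite_verts
    by (intro mult_right_mono) auto
  finally show ?case by (simp add: mult_ac)
qed

text \<open>The omitted hops are dominated by a geometric tail of value
  \<open>(1 - \<alpha>) ^ (L + 1)\<close>, where \<open>L\<close> is the depth, and
  \<open>L + 1\<close> exceeds the logarithm of \<theta> to base
  \<open>1 - \<alpha>\<close>.\<close>

lemma ppr_truncation_error:
  assumes "0 < \<alpha>" "\<alpha> < 1" "0 < \<theta>" "\<theta> < 1"
  shows "\<bar>(\<Sum>l\<le>rbs_depth \<alpha> \<theta>. hop_ppr G \<alpha> l s t) - ppr G \<alpha> s t\<bar> \<le> \<theta>"
proof -
  let ?L = "Suc (rbs_depth \<alpha> \<theta>)" and ?h = "\<lambda>l. hop_ppr G \<alpha> l s t"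
  have sums: "?h sums ppr G \<alpha> s t"
    by (rule ppr_sums_hop_ppr)
  have geo: "(\<lambda>i. \<alpha> * (1 - \<alpha>) ^ (i + ?L)) sums ((1 - \<alpha>) ^ ?L)"
    using sums_mult[OF geometric_sums[of "1 - \<alpha>"], of "\<alpha> * (1 - \<alpha>) ^ ?L"] assms
    by (simp add: power_add mult_ac)
  have eq: "ppr G \<alpha> s t - (\<Sum>l<?L. ?h l) = (\<Sum>i. ?h (i + ?L))"
    using suminf_minus_initial_segment[of ?h ?L] sums by (simp add: sums_iff)
  have sm: "summable (\<lambda>i. ?h (i + ?L))"
    using sums by (subst summable_iff_shift) (simp add: sums_iff)
  have "(\<Sum>i. ?h (i + ?L)) \<le> (1 - \<alpha>) ^ ?L"
    using suminf_le[OF hop_ppr_le sm sums_summable[OF geo]] geo assms by (simp add: sums_iff)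
  also have "\<dots> \<le> \<theta>"
  proof -
    have pos: "0 \<le> log (1 - \<alpha>) \<theta>"
      using assms by (simp add: log_def divide_nonpos_neg)
    \<comment> \<open>The successor in \<open>?L\<close> makes up for the rounding down in
      \<open>rbs_depth\<close>; nonnegativity of the logarithm makes \<open>nat\<close>
      harmless.\<close>
    have "log (1 - \<alpha>) \<theta> < real ?L"
      using pos unfolding rbs_depth_def by linarith
    then have "real ?L * ln (1 - \<alpha>) < ln \<theta>"
      using assms by (simp add: log_def divide_simps mult_ac split: if_splits)
    then have "exp (real ?L * ln (1 - \<alpha>)) < \<theta>"
      using assms by (metis exp_less_cancel_iff exp_ln)
    then show ?thesis
      using assms by (simp only: exp_of_nat_mult) simp
  qed
  finally have "(\<Sum>i. ?h (i + ?L)) \<le> \<theta>" .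
  moreover have "0 \<le> (\<Sum>i. ?h (i + ?L))"
    by (intro suminf_nonneg sm) simp
  ultimately show ?thesis
    using eq by (simp add: lessThan_Suc_atMost)
qed

lemma sum_hop_ppr_le_ppr: "(\<Sum>l\<in>A. hop_ppr G \<alpha> l s t) \<le> ppr G \<alpha> s t" if "finite A"
  using ppr_sums_hop_ppr[of G \<alpha> s t] that
  by (simp add: sums_iff) (metis hop_ppr_nonneg sum_le_suminf)

lemma sum_ppr_le_1: "(\<Sum>t\<in>pverts G. ppr G \<alpha> s t) \<le> 1"
  unfolding ppr_def by (intro sum_spmf_le_1 pair_finite_verts)

end

section \<open>A single update step\<close>

abbreviation unit_uniform :: "real measure" where
  "unit_uniform \<equiv> uniform_measure lborel {0<..<1}"

lemma prob_space_unit_uniform: "prob_space unit_uniform"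
  by (rule prob_space_uniform_measure) auto

interpretation unit_uniform: prob_space unit_uniform
  by (rule prob_space_unit_uniform)

text \<open>Positivity of \<open>lam\<close> is asked only at tails of arcs, because
  \<open>sqrt_degree\<close> vanishes at nodes without out-neighbors.\<close>

locale rbs_setup = pair_fin_digraph G for G :: "'a pair_pre_digraph" +
  fixes t :: 'a and \<alpha> \<theta> :: real and lam :: "'a \<Rightarrow> real"
  assumes target: "t \<in> pverts G"
    and \<alpha>: "0 < \<alpha>" "\<alpha> < 1"
    and \<theta>: "0 < \<theta>"
    and lam_pos: "\<And>u v. (u, v) \<in> parcs G \<Longrightarrow> 0 < lam u"
begin

lemmas [simp] = pair_finite_verts

abbreviation step :: "'a \<Rightarrow> 'a \<Rightarrow> real" where
  "step \<equiv> ppr_step G \<alpha>"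

lemma step_nonneg [simp]: "0 \<le> step u v"
  using \<alpha> by (simp add: ppr_step_def)

abbreviation level :: "(nat \<Rightarrow> 'a \<Rightarrow> real) \<Rightarrow> nat \<Rightarrow> 'a \<Rightarrow> real" where
  "level \<equiv> rbs_level G t \<alpha> \<theta> lam"

section \<open>The algorithm as a sum of increments along arcs\<close>

definition rbs_det :: "real \<Rightarrow> 'a \<Rightarrow> 'a \<Rightarrow> real" where
  "rbs_det x u v =
     (if (u, v) \<in> parcs G \<and> real (out_degree G u) \<le> rbs_threshold \<alpha> \<theta> lam x u
      then (1 - \<alpha>) * x / real (out_degree G u) else 0)"

definition rbs_rand :: "real \<Rightarrow> real \<Rightarrow> 'a \<Rightarrow> 'a \<Rightarrow> real" where
  "rbs_rand x r u v =
     (if (u, v) \<in> parcs G \<and> rbs_threshold \<alpha> \<theta> lam x u < real (out_degree G u)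
        \<and> real (out_degree G u) \<le> rbs_threshold \<alpha> \<theta> lam x u / r
      then \<alpha> * \<theta> / lam u else 0)"

text \<open>What \<open>v\<close>, with estimate \<open>x\<close> and draw \<open>r\<close>,
  contributes to \<open>u\<close>. The two threshold conditions exclude each other, so at most one
  summand is nonzero.\<close>

definition rbs_incr :: "real \<Rightarrow> real \<Rightarrow> 'a \<Rightarrow> 'a \<Rightarrow> real" where
  "rbs_incr x r u v = rbs_det x u v + rbs_rand x r u v"

lemma rbs_incr_nonneg: "0 \<le> x \<Longrightarrow> 0 \<le> rbs_incr x r u v"
  using \<alpha> \<theta>
  by (auto simp: rbs_incr_def rbs_det_def rbs_rand_def
      intro!: add_nonneg_nonneg divide_nonneg_nonneg less_imp_le[OF lam_pos])

text \<open>For \<open>x = 0\<close> the threshold is 0 while the tail of an arc has positive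
  out-degree, so neither kind of update takes place. Sums over the nodes with nonzero estimate thus
  extend to all nodes.\<close>

lemma rbs_incr_0 [simp]: "rbs_incr 0 r u v = 0"
  using out_degree_pos[of u v]
  by (auto simp: rbs_incr_def rbs_det_def rbs_rand_def rbs_threshold_def)

lemma rbs_level_Suc: "level r (Suc l) u = (\<Sum>v\<in>pverts G. rbs_incr (level r l v) (r l v) u v)"
proof -
  have "level r (Suc l) u = (\<Sum>v | v \<in> pverts G \<and> level r l v \<noteq> 0. rbs_incr (level r l v) (r l v) u v)"
    by (auto simp: rbs_incr_def rbs_det_def rbs_rand_def det_updates_def rand_updates_def
        in_nbrs_def intro!: sum.cong)
  also have "\<dots> = (\<Sum>v\<in>pverts G. rbs_incr (level r l v) (r l v) u v)"
    by (intro sum.mono_neutral_left) auto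
  finally show ?thesis .
qed

declare rbs_level.simps(2) [simp del]

lemma rbs_level_nonneg: "0 \<le> level r l u"
proof (induction l arbitrary: u)
  case (Suc l)
  then show ?case
    unfolding rbs_level_Suc by (intro sum_nonneg rbs_incr_nonneg)
qed (use \<alpha> in auto)

text \<open>Processing level \<open>i\<close> is what uses the draws \<open>r i v\<close>, so they
  first affect level \<open>i + 1\<close>. This is the adaptedness behind all conditioning on
  earlier levels.\<close>

lemma rbs_level_cong:
  assumes "\<And>i v. i < l \<Longrightarrow> v \<in> pverts G \<Longrightarrow> r i v = r' i v"
  shows "level r l u = level r' l u"
  using assms
proof (induction l arbitrary: u)
  case (Suc l)
  then have "level r l v = level r' l v" for v
    by simp
  then show ?case
    unfolding rbs_level_Suc using Suc.prems by simp
qed simp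

lemma measurable_rbs_incr [measurable]:
  assumes [measurable]: "f \<in> borel_measurable M" "g \<in> borel_measurable M"
  shows "(\<lambda>\<omega>. rbs_incr (f \<omega>) (g \<omega>) u v) \<in> borel_measurable M"
  unfolding rbs_incr_def rbs_det_def rbs_rand_def rbs_threshold_def by measurable

text \<open>Unbiasedness. A deterministic update adds exactly the mean; a random one adds
  \<open>\<alpha> * \<theta> / lam u\<close> with probability threshold over out-degree, and in the
  product \<open>lam u\<close> cancels.\<close>

lemma nn_integral_rbs_incr:
  assumes x: "0 \<le> x"
  shows "(\<integral>\<^sup>+r. ennreal (rbs_incr x r u v) \<partial>unit_uniform) = ennreal (step u v * x)"
proof -
  let ?d = "real (out_degree G u)" and ?T = "rbs_threshold \<alpha> \<theta> lam x u"
  consider "(u, v) \<notin> parcs G" | "(u, v) \<in> parcs G" "?d \<le> ?T" | "(u, v) \<in> parcs G" "?T < ?d"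
    by linarith
  then show ?thesis
  proof cases
    case 3
    have d: "0 < ?d" and lam: "0 < lam u"
      using out_degree_pos lam_pos 3 by auto
    have T: "0 \<le> ?T"
      using lam x \<alpha> \<theta> by (simp add: rbs_threshold_def)
    have "(\<integral>\<^sup>+r. ennreal (rbs_incr x r u v) \<partial>unit_uniform)
        = (\<integral>\<^sup>+r. ennreal (rbs_incr x r u v) * indicator {0<..<1} r \<partial>lborel)"
      by (subst nn_integral_uniform_measure) (auto simp: divide_ennreal_def)
    also have "\<dots> = (\<integral>\<^sup>+r. ennreal (\<alpha> * \<theta> / lam u) * indicator {0<..?T / ?d} r \<partial>lborel)"
    proof (rule nn_integral_cong)
      fix r :: real
      \<comment> \<open>The draws that trigger the update then form an initial interval lying inside
        the unit interval.\<close>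
      have "?T / ?d < 1"
        using 3 d by simp
      moreover have "r \<le> ?T / ?d \<longleftrightarrow> ?d \<le> ?T / r" if "0 < r"
        using that d by (simp add: field_simps)
      ultimately have "r \<in> {0<..?T / ?d} \<longleftrightarrow> r \<in> {0<..<1} \<and> ?d \<le> ?T / r"
        by auto
      then show "ennreal (rbs_incr x r u v) * indicator {0<..<1} r
        = ennreal (\<alpha> * \<theta> / lam u) * indicator {0<..?T / ?d} r"
        using 3 by (auto simp: rbs_incr_def rbs_det_def rbs_rand_def indicator_def)
    qed
    also have "\<dots> = ennreal (\<alpha> * \<theta> / lam u * (?T / ?d))"
      using T d lam \<alpha> \<theta> by (simp add: nn_integral_cmult_indicator flip: ennreal_mult)
    also have "\<alpha> * \<theta> / lam u * (?T / ?d) = step u v * x"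
      using 3 lam \<alpha> \<theta> by (simp add: rbs_threshold_def ppr_step_def)
    finally show ?thesis .
  qed (simp_all add: rbs_incr_def rbs_det_def rbs_rand_def ppr_step_def unit_uniform.emeasure_space_1)
qed

lemma has_bochner_integral_rbs_incr:
  "0 \<le> x \<Longrightarrow> has_bochner_integral unit_uniform (\<lambda>r. rbs_incr x r u v) (step u v * x)"
  by (rule has_bochner_integral_nn_integral)
    (auto simp: rbs_incr_nonneg nn_integral_rbs_incr)

text \<open>The largest possible \<open>w\<close>-weighted total of the random updates made by
  \<open>v\<close>, independent of its estimate. These updates share one draw, so they are bounded
  together as one random variable.\<close>

definition noise_width :: "('a \<Rightarrow> real) \<Rightarrow> 'a \<Rightarrow> real" where
  "noise_width w v = (\<Sum>u\<in>in_nbrs G v. w u * (\<alpha> * \<theta> / lam u))"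

text \<open>Hoeffding's lemma: the deterministic updates are a constant \<open>lo\<close>, and the
  random ones add between 0 and \<open>noise_width w v\<close> to it. The mean is known from
  unbiasedness.\<close>

lemma nn_integral_exp_rbs_incr_le:
  assumes x: "0 \<le> x" and w: "\<And>u. 0 \<le> w u"
  shows "(\<integral>\<^sup>+r. ennreal (exp (y * ((\<Sum>u\<in>pverts G. w u * rbs_incr x r u v)
      - (\<Sum>u\<in>pverts G. w u * step u v) * x))) \<partial>unit_uniform)
    \<le> ennreal (exp (y\<^sup>2 * (noise_width w v)\<^sup>2 / 8))"
proof -
  define f where "f r = (\<Sum>u\<in>pverts G. w u * rbs_incr x r u v)" for r
  define lo where "lo = (\<Sum>u\<in>pverts G. w u * rbs_det x u v)"
  have "has_bochner_integral unit_uniform f (\<Sum>u\<in>pverts G. w u * (step u v * x))"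
    unfolding f_def by (intro has_bochner_integral_sum has_bochner_integral_mult_right
        has_bochner_integral_rbs_incr x)
  then have E: "unit_uniform.expectation f = (\<Sum>u\<in>pverts G. w u * step u v) * x"
    by (simp add: has_bochner_integral_iff sum_distrib_left mult_ac)
  have [measurable]: "f \<in> borel_measurable unit_uniform"
    unfolding f_def by measurable
  have rand: "0 \<le> rbs_rand x r u v" "rbs_rand x r u v \<le> (if (u, v) \<in> parcs G then \<alpha> * \<theta> / lam u else 0)" for r u
    using lam_pos \<alpha> \<theta> by (auto simp: rbs_rand_def less_imp_le)
  have f: "f r = lo + (\<Sum>u\<in>pverts G. w u * rbs_rand x r u v)" for r
    by (simp add: f_def lo_def rbs_incr_def distrib_left sum.distrib)
  have ge: "lo \<le> f r" for r
    unfolding f using w rand by (simp add: sum_nonneg)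
  have "(\<Sum>u\<in>pverts G. w u * rbs_rand x r u v) \<le> noise_width w v" for r
  proof -
    have "(\<Sum>u\<in>pverts G. w u * rbs_rand x r u v)
        \<le> (\<Sum>u\<in>pverts G. w u * (if (u, v) \<in> parcs G then \<alpha> * \<theta> / lam u else 0))"
      using w rand by (intro sum_mono mult_left_mono) auto
    also have "\<dots> = noise_width w v"
      unfolding noise_width_def using wellformed'
      by (intro sum.mono_neutral_cong_right) (auto simp: in_nbrs_def)
    finally show ?thesis .
  qed
  then have le: "f r \<le> lo + noise_width w v" for r
    by (simp add: f)
  \<comment> \<open>Hoeffding's lemma is applied with a positive parameter; for negative
    \<open>y\<close> it is applied to the negated variable with parameter
    \<open>- y\<close>.\<close>
  consider "y = 0" | "0 < y" | "0 < - y"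
    by linarith
  then have "(\<integral>\<^sup>+r. ennreal (exp (y * (f r - unit_uniform.expectation f))) \<partial>unit_uniform)
    \<le> ennreal (exp (y\<^sup>2 * (noise_width w v)\<^sup>2 / 8))"
  proof cases
    case 1
    then show ?thesis by (simp add: unit_uniform.emeasure_space_1)
  next
    case 2
    interpret F: interval_bounded_random_variable unit_uniform f lo "lo + noise_width w v"
      by unfold_locales (use ge le in auto)
    show ?thesis
      using F.Hoeffdings_lemma_nn_integral[OF 2] by simp
  next
    case 3
    interpret F: interval_bounded_random_variable unit_uniform "\<lambda>r. - f r" "- lo - noise_width w v" "- lo"
      by unfold_locales (use ge le in \<open>auto simp: algebra_simps\<close>)
    show ?thesis
      using F.Hoeffdings_lemma_nn_integral[OF 3] by (simp add: algebra_simps)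
  qed
  then show ?thesis
    by (simp only: f_def E)
qed

section \<open>The draws of one copy\<close>

text \<open>The index shape of \<open>rbs_draws\<close> for one copy, with a free set of levels, so
  that single levels and initial segments of levels are both instances.\<close>

definition draws :: "nat set \<Rightarrow> (nat \<times> nat \<times> 'a \<Rightarrow> real) measure" where
  "draws A = (\<Pi>\<^sub>M i \<in> {..<1} \<times> A \<times> pverts G. unit_uniform)"

abbreviation copy :: "(nat \<times> nat \<times> 'a \<Rightarrow> real) \<Rightarrow> nat \<Rightarrow> 'a \<Rightarrow> real" where
  "copy \<omega> \<equiv> \<lambda>l v. \<omega> (0, l, v)"

lemma prob_space_draws: "prob_space (draws A)"
  unfolding draws_def by (intro prob_space_PiM prob_space_unit_uniform)

lemma sets_draws [measurable_cong]:
  "sets (draws A) = sets (\<Pi>\<^sub>M i \<in> {..<1} \<times> A \<times> pverts G. borel)"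
  unfolding draws_def by (intro sets_PiM_cong) auto

lemma measurable_component_draws:
  "l \<in> A \<Longrightarrow> v \<in> pverts G \<Longrightarrow> (\<lambda>\<omega>. \<omega> (0, l, v)) \<in> borel_measurable (draws A)"
  unfolding measurable_cong_sets[OF sets_draws refl] by (rule measurable_component_singleton) auto

lemma measurable_rbs_level:
  "{..<l} \<subseteq> A \<Longrightarrow> (\<lambda>\<omega>. level (copy \<omega>) l u) \<in> borel_measurable (draws A)"
proof (induction l arbitrary: u)
  case (Suc l)
  then have "{..<l} \<subseteq> A" "l \<in> A"
    by auto
  with Suc.IH show ?case
    unfolding rbs_level_Suc
    by (intro borel_measurable_sum measurable_rbs_incr measurable_component_draws) auto
qed simp

lemma nn_integral_draws_component:
  assumes "l \<in> A" "v \<in> pverts G" "f \<in> borel_measurable borel"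
  shows "(\<integral>\<^sup>+\<omega>. f (\<omega> (0, l, v)) \<partial>draws A) = (\<integral>\<^sup>+r. f r \<partial>unit_uniform)"
proof -
  have "(\<integral>\<^sup>+r. f r \<partial>unit_uniform)
      = (\<integral>\<^sup>+r. f r \<partial>distr (draws A) unit_uniform (\<lambda>\<omega>. \<omega> (0, l, v)))"
    unfolding draws_def using assms
    by (subst distr_PiM_component) (auto intro: prob_space_unit_uniform)
  also have "\<dots> = (\<integral>\<^sup>+\<omega>. f (\<omega> (0, l, v)) \<partial>draws A)"
    using assms by (intro nn_integral_distr)
      (auto intro: measurable_component_draws simp: measurable_cong_sets[of unit_uniform borel] cong: measurable_cong_sets)
  finally show ?thesis ..
qed

text \<open>Independence of the draws within one level, each node owning exactly one of
  them.\<close>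

lemma nn_integral_draws_prod:
  assumes "\<And>v. v \<in> pverts G \<Longrightarrow> f v \<in> borel_measurable borel"
  shows "(\<integral>\<^sup>+\<omega>. (\<Prod>v\<in>pverts G. f v (\<omega> (0, l, v))) \<partial>draws {l})
    = (\<Prod>v\<in>pverts G. \<integral>\<^sup>+r. f v r \<partial>unit_uniform)"
proof -
  interpret product_sigma_finite "\<lambda>_ :: nat \<times> nat \<times> 'a. unit_uniform"
    by unfold_locales
  have I: "{..<1::nat} \<times> {l} \<times> pverts G = (\<lambda>v. (0, l, v)) ` pverts G"
    by auto
  have inj: "inj_on (\<lambda>v. (0::nat, l, v)) (pverts G)"
    by (auto simp: inj_on_def)
  have "(\<integral>\<^sup>+\<omega>. (\<Prod>v\<in>pverts G. f v (\<omega> (0, l, v))) \<partial>draws {l})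
      = (\<integral>\<^sup>+\<omega>. (\<Prod>i\<in>{..<1::nat} \<times> {l} \<times> pverts G. f (snd (snd i)) (\<omega> i)) \<partial>draws {l})"
    unfolding I by (simp add: prod.reindex[OF inj])
  also have "\<dots> = (\<Prod>i\<in>{..<1::nat} \<times> {l} \<times> pverts G. \<integral>\<^sup>+r. f (snd (snd i)) r \<partial>unit_uniform)"
    unfolding draws_def using assms by (intro product_nn_integral_prod) auto
  also have "\<dots> = (\<Prod>v\<in>pverts G. \<integral>\<^sup>+r. f v r \<partial>unit_uniform)"
    unfolding I by (simp add: prod.reindex[OF inj])
  finally show ?thesis .
qed

section \<open>Integration level by level and unbiasedness of the estimates\<close>

definition add_level :: "nat \<Rightarrow> (nat \<times> nat \<times> 'a \<Rightarrow> real) \<Rightarrow> (nat \<times> nat \<times> 'a \<Rightarrow> real)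
    \<Rightarrow> nat \<times> nat \<times> 'a \<Rightarrow> real" where
  "add_level j x y = merge ({..<1} \<times> {..<j} \<times> pverts G) ({..<1} \<times> {j} \<times> pverts G) (x, y)"

lemma add_level_old: "i < j \<Longrightarrow> v \<in> pverts G \<Longrightarrow> add_level j x y (0, i, v) = x (0, i, v)"
  and add_level_new: "v \<in> pverts G \<Longrightarrow> add_level j x y (0, j, v) = y (0, j, v)"
  by (simp_all add: add_level_def merge_def)

text \<open>Fubini's theorem, in place of conditional expectation: the draws of level
  \<open>j\<close> are integrated while those of the earlier levels stay fixed.\<close>

lemma nn_integral_draws_Suc:
  assumes f: "f \<in> borel_measurable (draws {..<Suc j})"
  shows "(\<integral>\<^sup>+\<omega>. f \<omega> \<partial>draws {..<Suc j})
    = (\<integral>\<^sup>+x. \<integral>\<^sup>+y. f (add_level j x y) \<partial>draws {j} \<partial>draws {..<j})"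
proof -
  interpret product_sigma_finite "\<lambda>_ :: nat \<times> nat \<times> 'a. unit_uniform"
    by unfold_locales
  have eq: "{..<1} \<times> {..<Suc j} \<times> pverts G = ({..<1::nat} \<times> {..<j} \<times> pverts G) \<union> ({..<1} \<times> {j} \<times> pverts G)"
    by auto
  show ?thesis
    using f unfolding draws_def eq add_level_def
    by (subst product_nn_integral_fold) auto
qed

lemma rbs_level_add_level: "l \<le> j \<Longrightarrow> level (copy (add_level j x y)) l u = level (copy x) l u"
  by (rule rbs_level_cong) (simp add: add_level_old)

text \<open>Averaging over the draws of level \<open>j\<close> turns the estimates of level
  \<open>j + 1\<close> into \<open>ppr_step\<close> applied to those of level \<open>j\<close>,
  which is the recursion of \<open>hop_ppr\<close>. All levels up to \<open>j\<close> are treated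
  over the same draws, as the cost bound integrates them together.\<close>

lemma nn_integral_rbs_level:
  "l \<le> j \<Longrightarrow> u \<in> pverts G \<Longrightarrow>
    (\<integral>\<^sup>+\<omega>. ennreal (level (copy \<omega>) l u) \<partial>draws {..<j}) = ennreal (hop_ppr G \<alpha> l u t)"
proof (induction j arbitrary: l u)
  case 0
  interpret prob_space "draws {}" by (rule prob_space_draws)
  show ?case
    using 0 \<alpha> by (simp add: hop_ppr_0 emeasure_space_1)
next
  case (Suc j)
  interpret J: prob_space "draws {j}" by (rule prob_space_draws)
  show ?case
  proof (cases "l = Suc j")
    case False
    with Suc have "l \<le> j" by simp
    then show ?thesis
      using Suc by (subst nn_integral_draws_Suc)
        (auto simp: rbs_level_add_level J.emeasure_space_1
          intro!: measurable_compose[OF measurable_rbs_level measurable_ennreal])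
  next
    case True
    have meas: "(\<lambda>\<omega>. ennreal (level (copy \<omega>) (Suc j) u)) \<in> borel_measurable (draws {..<Suc j})"
      by (intro measurable_compose[OF measurable_rbs_level measurable_ennreal]) simp
    have "(\<integral>\<^sup>+\<omega>. ennreal (level (copy \<omega>) (Suc j) u) \<partial>draws {..<Suc j})
      = (\<integral>\<^sup>+x. \<integral>\<^sup>+y. ennreal (\<Sum>v\<in>pverts G. rbs_incr (level (copy x) j v) (y (0, j, v)) u v)
          \<partial>draws {j} \<partial>draws {..<j})"
      unfolding nn_integral_draws_Suc[OF meas]
      by (simp add: rbs_level_Suc rbs_level_add_level add_level_new)
    also have "\<dots> = (\<integral>\<^sup>+x. (\<Sum>v\<in>pverts G. ennreal (step u v) * ennreal (level (copy x) j v)) \<partial>draws {..<j})"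
    proof (rule nn_integral_cong)
      fix x
      have "(\<integral>\<^sup>+y. ennreal (\<Sum>v\<in>pverts G. rbs_incr (level (copy x) j v) (y (0, j, v)) u v) \<partial>draws {j})
        = (\<integral>\<^sup>+y. (\<Sum>v\<in>pverts G. ennreal (rbs_incr (level (copy x) j v) (y (0, j, v)) u v)) \<partial>draws {j})"
        by (simp add: rbs_incr_nonneg rbs_level_nonneg)
      also have "\<dots> = (\<Sum>v\<in>pverts G. \<integral>\<^sup>+y. ennreal (rbs_incr (level (copy x) j v) (y (0, j, v)) u v) \<partial>draws {j})"
        by (intro nn_integral_sum measurable_compose[OF _ measurable_ennreal] measurable_rbs_incr
            measurable_component_draws) auto
      also have "\<dots> = (\<Sum>v\<in>pverts G. ennreal (step u v * level (copy x) j v))"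
      proof (rule sum.cong[OF refl])
        fix v assume "v \<in> pverts G"
        then show "(\<integral>\<^sup>+y. ennreal (rbs_incr (level (copy x) j v) (y (0, j, v)) u v) \<partial>draws {j})
          = ennreal (step u v * level (copy x) j v)"
          using nn_integral_draws_component[of j "{j}" v "\<lambda>r. ennreal (rbs_incr (level (copy x) j v) r u v)"]
          by (simp add: nn_integral_rbs_incr rbs_level_nonneg)
      qed
      finally show "(\<integral>\<^sup>+y. ennreal (\<Sum>v\<in>pverts G. rbs_incr (level (copy x) j v) (y (0, j, v)) u v) \<partial>draws {j})
        = (\<Sum>v\<in>pverts G. ennreal (step u v) * ennreal (level (copy x) j v))"
        by (simp add: ennreal_mult rbs_level_nonneg)
    qed
    also have "\<dots> = (\<Sum>v\<in>pverts G. ennreal (step u v) * (\<integral>\<^sup>+x. ennreal (level (copy x) j v) \<partial>draws {..<j}))"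
      using measurable_compose[OF measurable_rbs_level measurable_ennreal]
      by (subst nn_integral_sum) (auto intro!: sum.cong nn_integral_cmult)
    also have "\<dots> = (\<Sum>v\<in>pverts G. ennreal (step u v * hop_ppr G \<alpha> j v t))"
      by (intro sum.cong refl) (simp add: Suc.IH ennreal_mult)
    also have "\<dots> = ennreal (hop_ppr G \<alpha> (Suc j) u t)"
      using \<alpha> by (simp add: hop_ppr_Suc)
    finally show ?thesis
      using True by simp
  qed
qed

section \<open>Expected cost of one copy\<close>

text \<open>A random update of \<open>u\<close> adds exactly
  \<open>\<alpha> * \<theta> / lam u\<close>, and a deterministic one at least that much by its
  threshold condition. The absolute value keeps the factor nonnegative at nodes without
  out-neighbors, where \<open>lam\<close> is unconstrained.\<close>

lemma rbs_cost_le: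
  "real (rbs_cost G t \<alpha> \<theta> lam r)
    \<le> (\<Sum>l<rbs_depth \<alpha> \<theta>. \<Sum>u\<in>pverts G. \<bar>lam u\<bar> / (\<alpha> * \<theta>) * level r (Suc l) u)"
proof -
  have single: "real (card (det_updates G \<alpha> \<theta> lam x v) + card (rand_updates G \<alpha> \<theta> lam r x v))
      \<le> (\<Sum>u\<in>pverts G. \<bar>lam u\<bar> / (\<alpha> * \<theta>) * rbs_incr x r u v)" if x: "0 \<le> x" for x r v
  proof -
    have upd: "det_updates G \<alpha> \<theta> lam x v \<subseteq> pverts G" "rand_updates G \<alpha> \<theta> lam r x v \<subseteq> pverts G"
      using wellformed' by (auto simp: det_updates_def rand_updates_def in_nbrs_def)
    have "real (card (det_updates G \<alpha> \<theta> lam x v) + card (rand_updates G \<alpha> \<theta> lam r x v))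
      = (\<Sum>u\<in>pverts G. indicator (det_updates G \<alpha> \<theta> lam x v) u + indicator (rand_updates G \<alpha> \<theta> lam r x v) u)"
      using upd by (simp add: sum.distrib indicator_def sum.If_cases Int_absorb1)
    also have "\<dots> \<le> (\<Sum>u\<in>pverts G. \<bar>lam u\<bar> / (\<alpha> * \<theta>) * rbs_incr x r u v)"
    proof (rule sum_mono)
      fix u
      show "indicator (det_updates G \<alpha> \<theta> lam x v) u + indicator (rand_updates G \<alpha> \<theta> lam r x v) u
        \<le> \<bar>lam u\<bar> / (\<alpha> * \<theta>) * rbs_incr x r u v"
      proof (cases "(u, v) \<in> parcs G")
        case True
        then show ?thesis
          using lam_pos[OF True] out_degree_pos[OF True] \<alpha> \<theta>
          by (auto simp: det_updates_def rand_updates_def in_nbrs_def rbs_incr_def rbs_det_def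
              rbs_rand_def rbs_threshold_def indicator_def field_simps)
      next
        case False
        then show ?thesis
          by (auto simp: det_updates_def rand_updates_def in_nbrs_def rbs_incr_def rbs_det_def
              rbs_rand_def)
      qed
    qed
    finally show ?thesis .
  qed
  have "real (rbs_cost G t \<alpha> \<theta> lam r)
      \<le> (\<Sum>l<rbs_depth \<alpha> \<theta>. \<Sum>v | v \<in> pverts G \<and> level r l v \<noteq> 0.
          \<Sum>u\<in>pverts G. \<bar>lam u\<bar> / (\<alpha> * \<theta>) * rbs_incr (level r l v) (r l v) u v)"
    unfolding rbs_cost_def of_nat_sum
    by (intro sum_mono single rbs_level_nonneg)
  also have "\<dots> = (\<Sum>l<rbs_depth \<alpha> \<theta>. \<Sum>v\<in>pverts G.
          \<Sum>u\<in>pverts G. \<bar>lam u\<bar> / (\<alpha> * \<theta>) * rbs_incr (level r l v) (r l v) u v)"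
    by (intro sum.cong[OF refl] sum.mono_neutral_left) auto
  also have "\<dots> = (\<Sum>l<rbs_depth \<alpha> \<theta>. \<Sum>u\<in>pverts G. \<bar>lam u\<bar> / (\<alpha> * \<theta>) * level r (Suc l) u)"
    unfolding rbs_level_Suc sum_distrib_left
    by (intro sum.cong[OF refl] sum.swap)
  finally show ?thesis .
qed

lemma rbs_draws_1: "rbs_draws G \<alpha> \<theta> 1 = draws {..<rbs_depth \<alpha> \<theta>}"
  by (simp add: rbs_draws_def draws_def)

text \<open>The mean of the estimate on level \<open>l + 1\<close> is the \<open>(l + 1)\<close>-hop
  PPR, and these values sum to at most the PPR.\<close>

lemma expected_cost_1_le:
  "expected_cost G t \<alpha> \<theta> lam 1 \<le> 1 / (\<alpha> * \<theta>) * (\<Sum>u\<in>pverts G. \<bar>lam u\<bar> * ppr G \<alpha> u t)"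
proof -
  let ?L = "rbs_depth \<alpha> \<theta>" and ?c = "\<lambda>u. \<bar>lam u\<bar> / (\<alpha> * \<theta>)"
  have c: "0 \<le> ?c u" for u
    using \<alpha> \<theta> by simp
  have "(\<integral>\<^sup>+\<omega>. ennreal (real (rbs_cost G t \<alpha> \<theta> lam (copy \<omega>))) \<partial>draws {..<?L})
    \<le> (\<integral>\<^sup>+\<omega>. (\<Sum>l<?L. \<Sum>u\<in>pverts G. ennreal (?c u) * ennreal (level (copy \<omega>) (Suc l) u)) \<partial>draws {..<?L})"
  proof (rule nn_integral_mono)
    fix \<omega>
    have "(\<Sum>l<?L. \<Sum>u\<in>pverts G. ennreal (?c u) * ennreal (level (copy \<omega>) (Suc l) u))
      = ennreal (\<Sum>l<?L. \<Sum>u\<in>pverts G. ?c u * level (copy \<omega>) (Suc l) u)"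
      using c by (simp only: ennreal_mult[OF c rbs_level_nonneg, symmetric] sum_ennreal
          mult_nonneg_nonneg rbs_level_nonneg sum_nonneg)
    then show "ennreal (real (rbs_cost G t \<alpha> \<theta> lam (copy \<omega>)))
      \<le> (\<Sum>l<?L. \<Sum>u\<in>pverts G. ennreal (?c u) * ennreal (level (copy \<omega>) (Suc l) u))"
      using rbs_cost_le by (simp only: ennreal_leI)
  qed
  also have "\<dots> = (\<Sum>l<?L. \<integral>\<^sup>+\<omega>. (\<Sum>u\<in>pverts G. ennreal (?c u) * ennreal (level (copy \<omega>) (Suc l) u)) \<partial>draws {..<?L})"
    by (intro nn_integral_sum borel_measurable_sum borel_measurable_times_ennreal borel_measurable_const
        measurable_compose[OF measurable_rbs_level measurable_ennreal]) auto
  also have "\<dots> = (\<Sum>l<?L. \<Sum>u\<in>pverts G. \<integral>\<^sup>+\<omega>. ennreal (?c u) * ennreal (level (copy \<omega>) (Suc l) u) \<partial>draws {..<?L})"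
    by (intro sum.cong[OF refl] nn_integral_sum borel_measurable_times_ennreal borel_measurable_const
        measurable_compose[OF measurable_rbs_level measurable_ennreal]) auto
  also have "\<dots> = (\<Sum>l<?L. \<Sum>u\<in>pverts G. ennreal (?c u * hop_ppr G \<alpha> (Suc l) u t))"
  proof (intro sum.cong[OF refl])
    fix l u assume "l \<in> {..<?L}" "u \<in> pverts G"
    then show "(\<integral>\<^sup>+\<omega>. ennreal (?c u) * ennreal (level (copy \<omega>) (Suc l) u) \<partial>draws {..<?L})
      = ennreal (?c u * hop_ppr G \<alpha> (Suc l) u t)"
      using measurable_compose[OF measurable_rbs_level measurable_ennreal, of "Suc l" "{..<?L}" u]
      by (subst nn_integral_cmult) (auto simp: nn_integral_rbs_level ennreal_mult[OF c hop_ppr_nonneg]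
          simp del: times_divide_eq_left)
  qed
  also have "\<dots> = ennreal (\<Sum>l<?L. \<Sum>u\<in>pverts G. ?c u * hop_ppr G \<alpha> (Suc l) u t)"
    using c by (simp only: sum_ennreal mult_nonneg_nonneg hop_ppr_nonneg sum_nonneg)
  also have "\<dots> \<le> ennreal (1 / (\<alpha> * \<theta>) * (\<Sum>u\<in>pverts G. \<bar>lam u\<bar> * ppr G \<alpha> u t))"
  proof (rule ennreal_leI)
    have "(\<Sum>l<?L. \<Sum>u\<in>pverts G. ?c u * hop_ppr G \<alpha> (Suc l) u t)
      = (\<Sum>u\<in>pverts G. ?c u * (\<Sum>l<?L. hop_ppr G \<alpha> (Suc l) u t))"
      by (subst sum.swap) (simp only: sum_distrib_left)
    also have "\<dots> \<le> (\<Sum>u\<in>pverts G. ?c u * ppr G \<alpha> u t)"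
    proof (intro sum_mono mult_left_mono c)
      fix u
      have "(\<Sum>l<?L. hop_ppr G \<alpha> (Suc l) u t) = (\<Sum>l\<in>Suc ` {..<?L}. hop_ppr G \<alpha> l u t)"
        by (simp add: sum.reindex)
      also have "\<dots> \<le> ppr G \<alpha> u t"
        by (intro sum_hop_ppr_le_ppr) simp
      finally show "(\<Sum>l<?L. hop_ppr G \<alpha> (Suc l) u t) \<le> ppr G \<alpha> u t" .
    qed
    finally show "(\<Sum>l<?L. \<Sum>u\<in>pverts G. ?c u * hop_ppr G \<alpha> (Suc l) u t)
      \<le> 1 / (\<alpha> * \<theta>) * (\<Sum>u\<in>pverts G. \<bar>lam u\<bar> * ppr G \<alpha> u t)"
      by (simp add: sum_distrib_left)
  qed
  finally have "(\<integral>\<^sup>+\<omega>. ennreal (real (rbs_cost G t \<alpha> \<theta> lam (copy \<omega>))) \<partial>draws {..<?L})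
    \<le> ennreal (1 / (\<alpha> * \<theta>) * (\<Sum>u\<in>pverts G. \<bar>lam u\<bar> * ppr G \<alpha> u t))" .
  \<comment> \<open>\<open>integral_real_bounded\<close> turns the bound on the nonnegative integral
    into one on the Lebesgue integral, which is 0 by convention if the function is not
    integrable.\<close>
  then show ?thesis
    unfolding expected_cost_def rbs_draws_1 median_rbs_cost_def using \<alpha> \<theta>
    by (intro integral_real_bounded) (auto intro!: mult_nonneg_nonneg sum_nonneg divide_nonneg_nonneg simp: ppr_def)
qed

section \<open>Concentration\<close>

text \<open>The truncated Green function: the expected number of visits to \<open>u\<close> within
  the first \<open>k\<close> moves of the walk from \<open>s\<close>. A unit of estimate at
  \<open>u\<close> on level \<open>j\<close> raises the expected total for \<open>s\<close> on the
  levels \<open>j\<close> to \<open>j + k\<close> by this amount.\<close>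

definition hops_upto :: "'a \<Rightarrow> nat \<Rightarrow> 'a \<Rightarrow> real" where
  "hops_upto s k u = (\<Sum>i\<le>k. hop_ppr G \<alpha> i s u) / \<alpha>"

lemma hops_upto_nonneg: "0 \<le> hops_upto s k u"
  using \<alpha> by (simp add: hops_upto_def sum_nonneg)

lemma hops_upto_0: "hops_upto s 0 u = (if s = u then 1 else 0)"
  using \<alpha> by (simp add: hops_upto_def hop_ppr_0)

lemma hops_upto_Suc:
  assumes "s \<in> pverts G" "v \<in> pverts G"
  shows "hops_upto s (Suc k) v
    = (if s = v then 1 else 0) + (\<Sum>u\<in>pverts G. hops_upto s k u * step u v)"
proof -
  have "(\<Sum>i\<le>Suc k. hop_ppr G \<alpha> i s v)
      = hop_ppr G \<alpha> 0 s v + (\<Sum>i\<le>k. \<Sum>u\<in>pverts G. hop_ppr G \<alpha> i s u * step u v)"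
    using assms \<alpha> by (subst sum.atMost_Suc_shift) (simp add: hop_ppr_Suc_last)
  also have "(\<Sum>i\<le>k. \<Sum>u\<in>pverts G. hop_ppr G \<alpha> i s u * step u v)
      = (\<Sum>u\<in>pverts G. (\<Sum>i\<le>k. hop_ppr G \<alpha> i s u) * step u v)"
    by (subst sum.swap) (simp add: sum_distrib_right)
  finally show ?thesis
    using \<alpha> by (auto simp: hops_upto_def hop_ppr_0 add_divide_distrib sum_divide_distrib[symmetric])
qed

text \<open>The expected number of nodes visited before termination is at most
  \<open>1 / \<alpha>\<close>, whatever the horizon \<open>k\<close>.\<close>

lemma sum_hops_upto_le: "(\<Sum>u\<in>pverts G. hops_upto s k u) \<le> 1 / \<alpha>"
proof -
  have "(\<Sum>u\<in>pverts G. \<Sum>i\<le>k. hop_ppr G \<alpha> i s u) \<le> 1"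
    by (subst sum.swap) (simp add: sum_hop_ppr_le_1)
  then show ?thesis
    using \<alpha> unfolding hops_upto_def sum_divide_distrib[symmetric] by (simp add: divide_right_mono)
qed

section \<open>Exponential moments of one level and of the whole martingale\<close>

text \<open>For fixed estimates \<open>x\<close> of level \<open>j\<close>, the nodes contribute
  independently and the exponential moment factorizes. The bound does not involve \<open>x\<close>,
  so it can be iterated over the levels.\<close>

lemma nn_integral_exp_level_le:
  assumes x: "\<And>v. 0 \<le> x v" and w: "\<And>u. 0 \<le> w u"
  shows "(\<integral>\<^sup>+\<omega>. ennreal (exp (y * ((\<Sum>u\<in>pverts G. w u * (\<Sum>v\<in>pverts G. rbs_incr (x v) (\<omega> (0, j, v)) u v))
      - (\<Sum>v\<in>pverts G. (\<Sum>u\<in>pverts G. w u * step u v) * x v)))) \<partial>draws {j})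
    \<le> ennreal (exp (y\<^sup>2 * (\<Sum>v\<in>pverts G. (noise_width w v)\<^sup>2) / 8))"
proof -
  define f where "f v r = y * ((\<Sum>u\<in>pverts G. w u * rbs_incr (x v) r u v)
      - (\<Sum>u\<in>pverts G. w u * step u v) * x v)" for v r
  have [measurable]: "f v \<in> borel_measurable borel" for v
    unfolding f_def by measurable
  \<comment> \<open>The terms are regrouped by the processed node \<open>v\<close>, because the
    draws belong to \<open>v\<close> and not to the updated node \<open>u\<close>.\<close>
  have "(\<Sum>u\<in>pverts G. w u * (\<Sum>v\<in>pverts G. rbs_incr (x v) (\<omega> (0, j, v)) u v))
      = (\<Sum>v\<in>pverts G. \<Sum>u\<in>pverts G. w u * rbs_incr (x v) (\<omega> (0, j, v)) u v)"
    for \<omega> :: "nat \<times> nat \<times> 'a \<Rightarrow> real"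
    unfolding sum_distrib_left by (rule sum.swap)
  then have "y * ((\<Sum>u\<in>pverts G. w u * (\<Sum>v\<in>pverts G. rbs_incr (x v) (\<omega> (0, j, v)) u v))
      - (\<Sum>v\<in>pverts G. (\<Sum>u\<in>pverts G. w u * step u v) * x v)) = (\<Sum>v\<in>pverts G. f v (\<omega> (0, j, v)))"
    for \<omega> :: "nat \<times> nat \<times> 'a \<Rightarrow> real"
    unfolding f_def sum_distrib_left[symmetric, of y] sum_subtractf by simp
  then have "(\<integral>\<^sup>+\<omega>. ennreal (exp (y * ((\<Sum>u\<in>pverts G. w u * (\<Sum>v\<in>pverts G. rbs_incr (x v) (\<omega> (0, j, v)) u v))
      - (\<Sum>v\<in>pverts G. (\<Sum>u\<in>pverts G. w u * step u v) * x v)))) \<partial>draws {j})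
    = (\<integral>\<^sup>+\<omega>. (\<Prod>v\<in>pverts G. ennreal (exp (f v (\<omega> (0, j, v))))) \<partial>draws {j})"
    by (simp add: exp_sum prod_ennreal)
  also have "\<dots> = (\<Prod>v\<in>pverts G. \<integral>\<^sup>+r. ennreal (exp (f v r)) \<partial>unit_uniform)"
    by (rule nn_integral_draws_prod) measurable
  also have "\<dots> \<le> (\<Prod>v\<in>pverts G. ennreal (exp (y\<^sup>2 * (noise_width w v)\<^sup>2 / 8)))"
    unfolding f_def by (intro prod_mono_ennreal nn_integral_exp_rbs_incr_le x w)
  also have "\<dots> = ennreal (exp (y\<^sup>2 * (\<Sum>v\<in>pverts G. (noise_width w v)\<^sup>2) / 8))"
    by (simp add: prod_ennreal sum_distrib_left sum_divide_distrib exp_sum)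
  finally show ?thesis .
qed

text \<open>
  The Doob martingale of the estimate for \<open>s\<close>: the conditional expectation of the sum of the
  levels up to \<open>L\<close>, given the draws of the levels below \<open>j\<close>.
\<close>

definition forecast :: "nat \<Rightarrow> 'a \<Rightarrow> nat \<Rightarrow> (nat \<Rightarrow> 'a \<Rightarrow> real) \<Rightarrow> real" where
  "forecast L s j r = (\<Sum>l<j. level r l s) + (\<Sum>u\<in>pverts G. hops_upto s (L - j) u * level r j u)"

lemma forecast_0: "forecast L s 0 r = (\<Sum>l\<le>L. hop_ppr G \<alpha> l s t)"
  using target \<alpha> by (simp add: forecast_def hops_upto_def mult_delta_right)

lemma forecast_last: "s \<in> pverts G \<Longrightarrow> forecast L s L r = (\<Sum>l\<le>L. level r l s)"
  by (simp add: forecast_def hops_upto_0 mult_delta_left lessThan_Suc_atMost[symmetric])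

text \<open>The visit at time 0 in \<open>hops_upto_Suc\<close> cancels the level that becomes
  final; what remains is the deviation of the weighted new level from its conditional mean.\<close>

lemma forecast_Suc:
  assumes "s \<in> pverts G" "j < L"
  shows "forecast L s (Suc j) r - forecast L s j r
    = (\<Sum>u\<in>pverts G. hops_upto s (L - Suc j) u * level r (Suc j) u)
      - (\<Sum>v\<in>pverts G. (\<Sum>u\<in>pverts G. hops_upto s (L - Suc j) u * step u v) * level r j v)"
proof -
  have L: "L - j = Suc (L - Suc j)"
    using assms by simp
  have "(\<Sum>v\<in>pverts G. hops_upto s (L - j) v * level r j v)
    = level r j s + (\<Sum>v\<in>pverts G. (\<Sum>u\<in>pverts G. hops_upto s (L - Suc j) u * step u v) * level r j v)"
    unfolding L using assms
    by (simp add: hops_upto_Suc distrib_right sum.distrib mult_delta_left)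
  then show ?thesis
    by (simp add: forecast_def)
qed

lemma forecast_cong:
  assumes "\<And>i v. i < j \<Longrightarrow> v \<in> pverts G \<Longrightarrow> r i v = r' i v"
  shows "forecast L s j r = forecast L s j r'"
proof -
  have "level r l u = level r' l u" if "l \<le> j" for l u
    using assms that by (intro rbs_level_cong) auto
  then show ?thesis
    by (simp add: forecast_def)
qed

lemma measurable_forecast:
  "{..<j} \<subseteq> A \<Longrightarrow> (\<lambda>\<omega>. forecast L s j (copy \<omega>)) \<in> borel_measurable (draws A)"
  unfolding forecast_def
  by (intro borel_measurable_add borel_measurable_sum borel_measurable_times borel_measurable_const
      measurable_rbs_level) auto

text \<open>Integrating out the last level multiplies the bound by
  \<open>exp (y\<^sup>2 * b / 8)\<close>, uniformly in the past. The horizon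
  \<open>L - Suc j\<close> of the weights varies with the step, so the width bound is assumed for
  every \<open>k\<close>.\<close>

lemma nn_integral_exp_forecast_le:
  assumes s: "s \<in> pverts G"
    and width: "\<And>k. (\<Sum>v\<in>pverts G. (noise_width (hops_upto s k) v)\<^sup>2) \<le> b"
  shows "j \<le> L \<Longrightarrow> (\<integral>\<^sup>+\<omega>. ennreal (exp (y * (forecast L s j (copy \<omega>) - forecast L s 0 (copy \<omega>)))) \<partial>draws {..<j})
    \<le> ennreal (exp (y\<^sup>2 * (real j * b) / 8))"
proof (induction j)
  case 0
  interpret prob_space "draws {}" by (rule prob_space_draws)
  show ?case by (simp add: emeasure_space_1)
next
  case (Suc j)
  define c where "c = (\<Sum>l\<le>L. hop_ppr G \<alpha> l s t)"
  \<comment> \<open>\<open>F\<close> depends on the earlier levels only; for a fixed past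
    \<open>x\<close> the increment \<open>D x\<close> depends only on the draws of level
    \<open>j\<close>.\<close>
  define F where "F \<omega> = forecast L s j (copy \<omega>) - c" for \<omega>
  define D where "D x \<omega> = (\<Sum>u\<in>pverts G. hops_upto s (L - Suc j) u *
        (\<Sum>v\<in>pverts G. rbs_incr (level (copy x) j v) (\<omega> (0, j, v)) u v))
      - (\<Sum>v\<in>pverts G. (\<Sum>u\<in>pverts G. hops_upto s (L - Suc j) u * step u v) * level (copy x) j v)"
    for x \<omega> :: "nat \<times> nat \<times> 'a \<Rightarrow> real"
  have D: "(\<integral>\<^sup>+\<omega>. ennreal (exp (y * D x \<omega>)) \<partial>draws {j}) \<le> ennreal (exp (y\<^sup>2 * b / 8))" for x
  proof -
    have "(\<integral>\<^sup>+\<omega>. ennreal (exp (y * D x \<omega>)) \<partial>draws {j})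
        \<le> ennreal (exp (y\<^sup>2 * (\<Sum>v\<in>pverts G. (noise_width (hops_upto s (L - Suc j)) v)\<^sup>2) / 8))"
      unfolding D_def by (intro nn_integral_exp_level_le rbs_level_nonneg hops_upto_nonneg)
    also have "\<dots> \<le> ennreal (exp (y\<^sup>2 * b / 8))"
      using width by (intro ennreal_leI) (simp add: mult_left_mono)
    finally show ?thesis .
  qed
  have [measurable]: "D x \<in> borel_measurable (draws {j})" for x
    unfolding D_def by (intro borel_measurable_diff borel_measurable_sum borel_measurable_times borel_measurable_const
      measurable_rbs_incr measurable_component_draws) auto
  have [measurable]: "F \<in> borel_measurable (draws {..<j})"
    unfolding F_def by (intro borel_measurable_diff measurable_forecast) auto
  have meas: "(\<lambda>\<omega>. ennreal (exp (y * (forecast L s (Suc j) (copy \<omega>) - forecast L s 0 (copy \<omega>)))))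
      \<in> borel_measurable (draws {..<Suc j})"
    using measurable_forecast[of "Suc j" "{..<Suc j}" L s] unfolding forecast_0 by measurable
  have "(\<integral>\<^sup>+\<omega>. ennreal (exp (y * (forecast L s (Suc j) (copy \<omega>) - forecast L s 0 (copy \<omega>)))) \<partial>draws {..<Suc j})
    = (\<integral>\<^sup>+x. \<integral>\<^sup>+\<omega>. ennreal (exp (y * F x)) * ennreal (exp (y * D x \<omega>)) \<partial>draws {j} \<partial>draws {..<j})"
    unfolding nn_integral_draws_Suc[OF meas]
  proof (intro nn_integral_cong)
    fix x \<omega>
    let ?m = "copy (add_level j x \<omega>)"
    have "forecast L s (Suc j) ?m - forecast L s j ?m = D x \<omega>"
      using s Suc.prems
      by (simp add: forecast_Suc D_def rbs_level_Suc rbs_level_add_level add_level_new)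
    moreover have "forecast L s j ?m = forecast L s j (copy x)"
      by (intro forecast_cong) (simp add: add_level_old)
    ultimately have "forecast L s (Suc j) ?m - forecast L s 0 ?m = F x + D x \<omega>"
      by (simp add: forecast_0 F_def c_def)
    then show "ennreal (exp (y * (forecast L s (Suc j) ?m - forecast L s 0 ?m)))
        = ennreal (exp (y * F x)) * ennreal (exp (y * D x \<omega>))"
      by (simp add: distrib_left exp_add ennreal_mult)
  qed
  also have "\<dots> = (\<integral>\<^sup>+x. ennreal (exp (y * F x)) * (\<integral>\<^sup>+\<omega>. ennreal (exp (y * D x \<omega>)) \<partial>draws {j}) \<partial>draws {..<j})"
    by (intro nn_integral_cong nn_integral_cmult) measurable
  also have "\<dots> \<le> (\<integral>\<^sup>+x. ennreal (exp (y * F x)) * ennreal (exp (y\<^sup>2 * b / 8)) \<partial>draws {..<j})"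
    by (intro nn_integral_mono mult_left_mono D) simp
  also have "\<dots> = (\<integral>\<^sup>+x. ennreal (exp (y * F x)) \<partial>draws {..<j}) * ennreal (exp (y\<^sup>2 * b / 8))"
    by (intro nn_integral_multc) measurable
  also have "\<dots> \<le> ennreal (exp (y\<^sup>2 * (real j * b) / 8)) * ennreal (exp (y\<^sup>2 * b / 8))"
    using Suc by (intro mult_right_mono) (auto simp: F_def forecast_0 c_def)
  also have "\<dots> = ennreal (exp (y\<^sup>2 * (real (Suc j) * b) / 8))"
    by (simp add: ennreal_mult[symmetric] exp_add[symmetric] algebra_simps add_divide_distrib)
  finally show ?case .
qed

section \<open>Deviation at one node and at all nodes\<close>

text \<open>Chernoff's bound with parameter \<open>1 / \<theta>\<close> for either sign, which
  reduces the variance term to an eighth of the depth. The parameter is not optimized: the depth is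
  only logarithmic and is outweighed later by \<open>a / \<theta>\<close>.\<close>

lemma rbs_tail_bound:
  assumes s: "s \<in> pverts G"
    and width: "\<And>k. (\<Sum>v\<in>pverts G. (noise_width (hops_upto s k) v)\<^sup>2) \<le> \<theta>\<^sup>2"
  shows "measure (draws {..<rbs_depth \<alpha> \<theta>}) {\<omega> \<in> space (draws {..<rbs_depth \<alpha> \<theta>}).
      a < \<bar>rbs G t \<alpha> \<theta> lam (copy \<omega>) s - (\<Sum>l\<le>rbs_depth \<alpha> \<theta>. hop_ppr G \<alpha> l s t)\<bar>}
    \<le> 2 * exp (real (rbs_depth \<alpha> \<theta>) / 8 - a / \<theta>)"
proof -
  let ?L = "rbs_depth \<alpha> \<theta>"
  let ?M = "draws {..<?L}"
  interpret prob_space ?M by (rule prob_space_draws)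
  define X where "X \<omega> = rbs G t \<alpha> \<theta> lam (copy \<omega>) s - (\<Sum>l\<le>?L. hop_ppr G \<alpha> l s t)" for \<omega>
  have X: "X \<omega> = forecast ?L s ?L (copy \<omega>) - forecast ?L s 0 (copy \<omega>)" for \<omega>
    by (simp add: X_def rbs_def forecast_0 forecast_last s)
  have [measurable]: "X \<in> borel_measurable ?M"
    unfolding X forecast_0 by (intro borel_measurable_diff measurable_forecast) auto
  have tail: "measure ?M {\<omega> \<in> space ?M. a < \<sigma> * X \<omega>} \<le> exp (real ?L / 8 - a / \<theta>)"
    if \<sigma>: "\<sigma>\<^sup>2 = 1" for \<sigma>
  proof -
    have "emeasure ?M {\<omega> \<in> space ?M. a < \<sigma> * X \<omega>}
        \<le> emeasure ?M {\<omega> \<in> space ?M. 1 \<le> ennreal (exp (- a / \<theta>)) * ennreal (exp (\<sigma> / \<theta> * X \<omega>))}"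
    proof (intro emeasure_mono)
      show "{\<omega> \<in> space ?M. a < \<sigma> * X \<omega>}
        \<subseteq> {\<omega> \<in> space ?M. 1 \<le> ennreal (exp (- a / \<theta>)) * ennreal (exp (\<sigma> / \<theta> * X \<omega>))}"
        using \<theta> by (auto simp: ennreal_mult[symmetric] exp_add[symmetric] divide_right_mono
            simp flip: ennreal_1 add_divide_distrib)
    qed measurable
    also have "\<dots> \<le> ennreal (exp (- a / \<theta>)) * (\<integral>\<^sup>+\<omega>. ennreal (exp (\<sigma> / \<theta> * X \<omega>)) * indicator (space ?M) \<omega> \<partial>?M)"
      by (rule nn_integral_Markov_inequality) measurable
    also have "(\<integral>\<^sup>+\<omega>. ennreal (exp (\<sigma> / \<theta> * X \<omega>)) * indicator (space ?M) \<omega> \<partial>?M)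
        = (\<integral>\<^sup>+\<omega>. ennreal (exp (\<sigma> / \<theta> * X \<omega>)) \<partial>?M)"
      by (intro nn_integral_cong) simp
    also have "\<dots> \<le> ennreal (exp ((\<sigma> / \<theta>)\<^sup>2 * (real ?L * \<theta>\<^sup>2) / 8))"
      unfolding X by (intro nn_integral_exp_forecast_le s width) simp
    also have "(\<sigma> / \<theta>)\<^sup>2 * (real ?L * \<theta>\<^sup>2) = real ?L"
      using \<theta> \<sigma> by (simp add: power_divide)
    also have "ennreal (exp (- a / \<theta>)) * ennreal (exp (real ?L / 8)) = ennreal (exp (real ?L / 8 - a / \<theta>))"
      by (simp add: ennreal_mult[symmetric] exp_add[symmetric])
    finally show ?thesis
      by (simp add: emeasure_eq_measure mult_left_mono)
  qed
  have "measure ?M {\<omega> \<in> space ?M. a < \<bar>X \<omega>\<bar>}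
      \<le> measure ?M ({\<omega> \<in> space ?M. a < 1 * X \<omega>} \<union> {\<omega> \<in> space ?M. a < - 1 * X \<omega>})"
    by (intro finite_measure_mono) (auto simp: abs_if)
  also have "\<dots> \<le> measure ?M {\<omega> \<in> space ?M. a < 1 * X \<omega>} + measure ?M {\<omega> \<in> space ?M. a < - 1 * X \<omega>}"
    by (intro measure_Un_le) measurable
  also have "\<dots> \<le> 2 * exp (real ?L / 8 - a / \<theta>)"
    using tail[of 1] tail[of "- 1"] by simp
  finally show ?thesis
    by (simp add: X_def)
qed

text \<open>The square root in the sampling function is what balances the two Cauchy--Schwarz factors.\<close>

lemma sum_noise_width_sqrt_degree_le:
  assumes lam: "lam = sqrt_degree G"
    and w: "\<And>u. 0 \<le> w u" "(\<Sum>u\<in>pverts G. w u) \<le> 1 / \<alpha>"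
  shows "(\<Sum>v\<in>pverts G. (noise_width w v)\<^sup>2) \<le> \<theta>\<^sup>2"
proof -
  let ?d = "\<lambda>u. real (out_degree G u)"
  have inV: "in_nbrs G v \<subseteq> pverts G" "out_nbrs G v \<subseteq> pverts G" for v
    using wellformed' by (auto simp: in_nbrs_def out_nbrs_def)
  have "(noise_width w v)\<^sup>2 \<le> (\<alpha> * \<theta>)\<^sup>2 * ((\<Sum>u\<in>in_nbrs G v. w u / ?d u) * (1 / \<alpha>))" for v
  proof -
    \<comment> \<open>This splitting gives one Cauchy-Schwarz factor that spreads the weight of each
      node evenly over its out-neighbors and one that is bounded by the total weight.\<close>
    have "noise_width w v = \<alpha> * \<theta> * (\<Sum>u\<in>in_nbrs G v. sqrt (w u / ?d u) * sqrt (w u))"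
      unfolding noise_width_def sum_distrib_left using w(1)
      by (intro sum.cong) (simp_all add: lam sqrt_degree_def real_sqrt_divide)
    then have "(noise_width w v)\<^sup>2 = (\<alpha> * \<theta>)\<^sup>2 * (\<Sum>u\<in>in_nbrs G v. sqrt (w u / ?d u) * sqrt (w u))\<^sup>2"
      by (simp only: power_mult_distrib)
    also have "\<dots> \<le> (\<alpha> * \<theta>)\<^sup>2 * ((\<Sum>u\<in>in_nbrs G v. (sqrt (w u / ?d u))\<^sup>2) * (\<Sum>u\<in>in_nbrs G v. (sqrt (w u))\<^sup>2))"
      by (intro mult_left_mono Cauchy_Schwarz_ineq_sum) simp
    also have "\<dots> = (\<alpha> * \<theta>)\<^sup>2 * ((\<Sum>u\<in>in_nbrs G v. w u / ?d u) * (\<Sum>u\<in>in_nbrs G v. w u))"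
      using w by simp
    also have "\<dots> \<le> (\<alpha> * \<theta>)\<^sup>2 * ((\<Sum>u\<in>in_nbrs G v. w u / ?d u) * (1 / \<alpha>))"
      using order_trans[OF sum_mono2[OF pair_finite_verts inV(1) w(1)] w(2)] w(1)
      by (intro mult_left_mono sum_nonneg) auto
    finally show ?thesis .
  qed
  then have "(\<Sum>v\<in>pverts G. (noise_width w v)\<^sup>2)
      \<le> (\<Sum>v\<in>pverts G. (\<alpha> * \<theta>)\<^sup>2 * ((\<Sum>u\<in>in_nbrs G v. w u / ?d u) * (1 / \<alpha>)))"
    by (intro sum_mono)
  also have "\<dots> = (\<alpha> * \<theta>)\<^sup>2 * ((\<Sum>v\<in>pverts G. \<Sum>u\<in>in_nbrs G v. w u / ?d u) * (1 / \<alpha>))"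
    by (simp only: sum_distrib_left sum_distrib_right)
  \<comment> \<open>Double counting of arcs: each \<open>u\<close> occurs once per out-neighbor,
    with share \<open>w u / ?d u\<close>, and so contributes at most \<open>w u\<close>.\<close>
  also have "(\<Sum>v\<in>pverts G. \<Sum>u\<in>in_nbrs G v. w u / ?d u)
      = (\<Sum>v\<in>pverts G. \<Sum>u\<in>{u \<in> pverts G. (u, v) \<in> parcs G}. w u / ?d u)"
    using wellformed' by (intro sum.cong) (auto simp: in_nbrs_def)
  also have "\<dots> = (\<Sum>u\<in>pverts G. \<Sum>v\<in>{v \<in> pverts G. (u, v) \<in> parcs G}. w u / ?d u)"
    by (rule sum.swap_restrict) auto
  also have "\<dots> = (\<Sum>u\<in>pverts G. \<Sum>v\<in>out_nbrs G u. w u / ?d u)"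
    using wellformed' by (intro sum.cong) (auto simp: out_nbrs_def)
  also have "(\<alpha> * \<theta>)\<^sup>2 * ((\<Sum>u\<in>pverts G. \<Sum>v\<in>out_nbrs G u. w u / ?d u) * (1 / \<alpha>))
      \<le> (\<alpha> * \<theta>)\<^sup>2 * ((1 / \<alpha>) * (1 / \<alpha>))"
  proof (intro mult_left_mono mult_right_mono)
    have "(\<Sum>u\<in>pverts G. \<Sum>v\<in>out_nbrs G u. w u / ?d u) \<le> (\<Sum>u\<in>pverts G. w u)"
      using w by (intro sum_mono) (simp add: out_degree_eq_card_out_nbrs)
    then show "(\<Sum>u\<in>pverts G. \<Sum>v\<in>out_nbrs G u. w u / ?d u) \<le> 1 / \<alpha>"
      using w by simp
  qed (use \<alpha> in auto)
  also have "\<dots> = \<theta>\<^sup>2"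
    using \<alpha> by (simp add: power2_eq_square)
  finally show ?thesis .
qed

text \<open>Union bound over the nodes; in the error \<open>a + \<theta>\<close>, the part
  \<open>a\<close> pays for the random deviation and \<theta> for the truncation of the
  walk.\<close>

lemma prob_median_rbs_1:
  assumes lam: "lam = sqrt_degree G" and "\<theta> < 1"
  shows "\<P>(\<omega> in rbs_draws G \<alpha> \<theta> 1.
      \<forall>s\<in>pverts G. \<bar>median_rbs G t \<alpha> \<theta> lam 1 \<omega> s - ppr G \<alpha> s t\<bar> \<le> a + \<theta>)
    \<ge> 1 - real (card (pverts G)) * (2 * exp (real (rbs_depth \<alpha> \<theta>) / 8 - a / \<theta>))"
proof -
  let ?L = "rbs_depth \<alpha> \<theta>" and ?M = "rbs_draws G \<alpha> \<theta> 1"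
  let ?est = "\<lambda>\<omega> s. rbs G t \<alpha> \<theta> lam (copy \<omega>) s" and ?trunc = "\<lambda>s. \<Sum>l\<le>rbs_depth \<alpha> \<theta>. hop_ppr G \<alpha> l s t"
  interpret prob_space ?M
    unfolding rbs_draws_1 by (rule prob_space_draws)
  define bad where "bad s = {\<omega> \<in> space ?M. a + \<theta> < \<bar>?est \<omega> s - ppr G \<alpha> s t\<bar>}" for s
  have [measurable]: "(\<lambda>\<omega>. ?est \<omega> s) \<in> borel_measurable ?M" for s
    unfolding rbs_def rbs_draws_1 by (intro borel_measurable_sum measurable_rbs_level) auto
  have bad: "bad s \<in> events" for s
    unfolding bad_def by measurable
  have "prob (bad s) \<le> 2 * exp (real ?L / 8 - a / \<theta>)" if s: "s \<in> pverts G" for s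
  proof -
    have "prob (bad s) \<le> prob {\<omega> \<in> space ?M. a < \<bar>?est \<omega> s - ?trunc s\<bar>}"
    proof (intro finite_measure_mono)
      show "bad s \<subseteq> {\<omega> \<in> space ?M. a < \<bar>?est \<omega> s - ?trunc s\<bar>}"
        using ppr_truncation_error[OF \<alpha> \<theta> \<open>\<theta> < 1\<close>, of s t] by (auto simp: bad_def)
    qed measurable
    also have "\<dots> \<le> 2 * exp (real ?L / 8 - a / \<theta>)"
      unfolding rbs_draws_1
      by (intro rbs_tail_bound s sum_noise_width_sqrt_degree_le lam hops_upto_nonneg sum_hops_upto_le)
    finally show ?thesis .
  qed
  then have "prob (\<Union>s\<in>pverts G. bad s) \<le> (\<Sum>s\<in>pverts G. 2 * exp (real ?L / 8 - a / \<theta>))"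
    using bad by (intro order_trans[OF finite_measure_subadditive_finite] sum_mono) auto
  moreover have "prob (space ?M - (\<Union>s\<in>pverts G. bad s)) = 1 - prob (\<Union>s\<in>pverts G. bad s)"
    using bad by (intro prob_compl sets.finite_UN) auto
  \<comment> \<open>For one copy both middle positions of the list are 0, so the median is the
    estimate itself.\<close>
  moreover have "{\<omega> \<in> space ?M. \<forall>s\<in>pverts G. \<bar>median_rbs G t \<alpha> \<theta> lam 1 \<omega> s - ppr G \<alpha> s t\<bar> \<le> a + \<theta>}
      = space ?M - (\<Union>s\<in>pverts G. bad s)"
    by (auto simp: bad_def median_rbs_def median_def not_less)
  ultimately show ?thesis
    unfolding sum_constant by simp
qed

end

section \<open>The choice of the error parameter\<close>

lemma polylog_1_ge:
  assumes "1 \<le> n" "0 < \<epsilon>" "\<epsilon> < 1"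
  shows "1 + ln (real n) \<le> polylog 1 n \<epsilon>" "ln (1 / \<epsilon>) \<le> polylog 1 n \<epsilon>" "1 \<le> polylog 1 n \<epsilon>"
proof -
  have "0 \<le> ln (real n)" "0 \<le> ln (1 / \<epsilon>)"
    using assms by auto
  then show "1 + ln (real n) \<le> polylog 1 n \<epsilon>" "ln (1 / \<epsilon>) \<le> polylog 1 n \<epsilon>" "1 \<le> polylog 1 n \<epsilon>"
    by (auto simp: polylog_def)
qed

text \<open>The term \<open>(\<epsilon> / 2) / \<theta>\<close> equals
  \<open>B * \<Lambda> / 2\<close>, linear in \<open>B\<close>, whereas the depth is at most
  \<open>\<Lambda>\<close> times a constant growing like \<open>ln B\<close>. The assumption on
  \<open>B\<close> states that the former wins by \<open>(c + 2) * \<Lambda>\<close>.\<close>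

lemma failure_probability_le:
  fixes \<alpha> B c \<epsilon> :: real and n :: nat
  defines "\<Lambda> \<equiv> polylog 1 n \<epsilon>"
  defines "\<theta> \<equiv> \<epsilon> / (B * \<Lambda>)"
  assumes "0 < \<alpha>" "\<alpha> < 1" "0 < c" "1 \<le> n" "0 < \<epsilon>" "\<epsilon> < 1" "2 \<le> B"
    and B: "c + 2 \<le> B / 2 - (2 + ln B) / (8 * (- ln (1 - \<alpha>)))"
  shows "real n * (2 * exp (real (rbs_depth \<alpha> \<theta>) / 8 - (\<epsilon> / 2) / \<theta>)) \<le> 1 / real n powr c"
proof -
  define \<beta> where "\<beta> = - ln (1 - \<alpha>)"
  have \<beta>: "0 < \<beta>"
    using assms by (simp add: \<beta>_def)
  have \<Lambda>: "1 + ln (real n) \<le> \<Lambda>" "ln (1 / \<epsilon>) \<le> \<Lambda>" "1 \<le> \<Lambda>"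
    unfolding \<Lambda>_def using assms by (intro polylog_1_ge; simp)+
  have B\<Lambda>: "2 * 1 \<le> B * \<Lambda>"
    using assms(9) \<Lambda>(3) by (intro mult_mono) auto
  then have \<theta>: "0 < \<theta>" "\<theta> < 1"
    using assms by (auto simp: \<theta>_def field_simps)
  have "- ln \<theta> = ln B + ln \<Lambda> + ln (1 / \<epsilon>)"
    unfolding \<theta>_def using assms \<Lambda> by (simp add: ln_div ln_mult)
  also have "\<dots> \<le> ln B * \<Lambda> + \<Lambda> + \<Lambda>"
    using \<Lambda> ln_bound[of \<Lambda>] mult_left_mono[of 1 \<Lambda> "ln B"] assms(9) by (intro add_mono) auto
  finally have "- ln \<theta> \<le> (2 + ln B) * \<Lambda>"
    by (simp add: algebra_simps)
  then have "- ln \<theta> / \<beta> \<le> (2 + ln B) * \<Lambda> / \<beta>"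
    using \<beta> by (intro divide_right_mono) auto
  moreover have "real (rbs_depth \<alpha> \<theta>) \<le> - ln \<theta> / \<beta>"
  proof -
    have "log (1 - \<alpha>) \<theta> = - ln \<theta> / \<beta>"
      by (simp add: log_def \<beta>_def)
    moreover have "0 \<le> - ln \<theta> / \<beta>"
      using \<theta> \<beta> by (intro divide_nonneg_nonneg) auto
    ultimately show ?thesis
      unfolding rbs_depth_def by linarith
  qed
  ultimately have "real (rbs_depth \<alpha> \<theta>) / 8 - (\<epsilon> / 2) / \<theta> \<le> ((2 + ln B) * \<Lambda> / \<beta>) / 8 - B * \<Lambda> / 2"
    using assms by (simp add: \<theta>_def)
  also have "\<dots> = - (\<Lambda> * (B / 2 - (2 + ln B) / (8 * \<beta>)))"
    using \<beta> by (simp add: field_simps)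
  also have "\<dots> \<le> - (\<Lambda> * (c + 2))"
    using B \<Lambda> unfolding \<beta>_def by (intro le_imp_neg_le mult_left_mono) auto
  also have "\<dots> \<le> - ((1 + ln (real n)) * (c + 2))"
    using \<Lambda> assms by (intro le_imp_neg_le mult_right_mono) auto
  \<comment> \<open>Of the margin \<open>c + 2\<close>, the constant 1 absorbs the factor 2 of the
    two tails, one \<open>ln n\<close> the union bound, and \<open>c\<close> times
    \<open>ln n\<close> remains.\<close>
  also have "\<dots> \<le> - 1 - (c + 1) * ln (real n)"
  proof -
    have "0 \<le> ln (real n)"
      using assms by simp
    then show ?thesis
      using \<open>0 < c\<close> by (simp add: algebra_simps)
  qed
  finally have "2 * exp (real (rbs_depth \<alpha> \<theta>) / 8 - (\<epsilon> / 2) / \<theta>)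
      \<le> exp 1 * exp (- 1 - (c + 1) * ln (real n))"
    using exp_ge_add_one_self[of 1] by (intro mult_mono) auto
  then have "real n * (2 * exp (real (rbs_depth \<alpha> \<theta>) / 8 - (\<epsilon> / 2) / \<theta>))
      \<le> exp (ln (real n)) * (exp 1 * exp (- 1 - (c + 1) * ln (real n)))"
    using assms by (simp add: mult_left_mono)
  also have "\<dots> = 1 / real n powr c"
  proof -
    have "exp (ln (real n)) * (exp 1 * exp (- 1 - (c + 1) * ln (real n))) = exp (- (c * ln (real n)))"
      unfolding exp_add[symmetric] by (simp add: algebra_simps)
    also have "\<dots> = 1 / real n powr c"
      using assms by (simp add: powr_def exp_minus inverse_eq_divide)
    finally show ?thesis .
  qed
  finally show ?thesis .
qed

section \<open>Average degree, choice of constants and assembly\<close>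

text \<open>Cauchy-Schwarz against the constant 1, together with the fact that the out-degrees sum
  to the number of arcs.\<close>

lemma (in pair_fin_digraph) sum_sqrt_out_degree_le:
  "(\<Sum>u\<in>pverts G. sqrt (real (out_degree G u))) / real (card (pverts G))
    \<le> sqrt (real (card (parcs G)) / real (card (pverts G)))"
proof -
  let ?n = "real (card (pverts G))"
  have "(\<Sum>u\<in>pverts G. sqrt (real (out_degree G u)) * 1)\<^sup>2
      \<le> (\<Sum>u\<in>pverts G. (sqrt (real (out_degree G u)))\<^sup>2) * (\<Sum>u\<in>pverts G. 1\<^sup>2)"
    by (rule Cauchy_Schwarz_ineq_sum)
  also have "\<dots> = real (card (parcs G)) * ?n"
    by (simp flip: sum_out_degree)
  finally have "(\<Sum>u\<in>pverts G. sqrt (real (out_degree G u))) \<le> sqrt (real (card (parcs G)) * ?n)"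
    by (intro real_le_rsqrt) simp
  then have "(\<Sum>u\<in>pverts G. sqrt (real (out_degree G u))) / ?n \<le> sqrt (real (card (parcs G)) * ?n) / ?n"
    by (intro divide_right_mono) auto
  also have "\<dots> = sqrt (real (card (parcs G)) * ?n / ?n\<^sup>2)"
    by (simp add: real_sqrt_divide)
  also have "\<dots> = sqrt (real (card (parcs G)) / ?n)"
    by (simp add: power2_eq_square)
  finally show ?thesis .
qed

lemma (in pair_fin_digraph) rbs_setup_sqrt_degree:
  assumes "t \<in> pverts G" "0 < \<alpha>" "\<alpha> < 1" "0 < \<theta>"
  shows "rbs_setup G t \<alpha> \<theta> (sqrt_degree G)"
  using assms out_degree_pos by unfold_locales (auto simp: sqrt_degree_def)

theorem theorem4p2:
  fixes \<alpha> c :: real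
  assumes "0 < \<alpha>" "\<alpha> < 1" "0 < c"
  shows "\<exists>(\<theta> :: nat \<Rightarrow> real \<Rightarrow> real) (K :: nat \<Rightarrow> nat) (C :: real) (k :: nat).
    0 < C \<and>
    (\<forall>n\<ge>1. 1 \<le> K n \<and> real (K n) \<le> C * (1 + ln (real n))) \<and>
    (\<forall>n\<ge>1. \<forall>\<epsilon>. 0 < \<epsilon> \<and> \<epsilon> < 1 \<longrightarrow>
       0 < \<theta> n \<epsilon> \<and> \<theta> n \<epsilon> < 1 \<and>
       \<epsilon> / (C * polylog k n \<epsilon>) \<le> \<theta> n \<epsilon> \<and> \<theta> n \<epsilon> \<le> C * polylog k n \<epsilon> * \<epsilon>) \<and>
    (\<forall>(G :: 'a pair_pre_digraph) n m \<epsilon>.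
       pair_fin_digraph G \<and> pverts G \<noteq> {} \<and> n = card (pverts G) \<and> m = card (parcs G) \<and>
       0 < \<epsilon> \<and> \<epsilon> < 1 \<longrightarrow>
       (\<forall>t \<in> pverts G.
          \<P>(\<omega> in rbs_draws G \<alpha> (\<theta> n \<epsilon>) (K n).
             \<forall>s \<in> pverts G.
               \<bar>median_rbs G t \<alpha> (\<theta> n \<epsilon>) (sqrt_degree G) (K n) \<omega> s - ppr G \<alpha> s t\<bar> \<le> \<epsilon>)
          \<ge> 1 - 1 / real n powr c \<and>
          expected_cost G t \<alpha> (\<theta> n \<epsilon>) (sqrt_degree G) (K n)
          \<le> C * polylog k n \<epsilon> *
              (1 / \<epsilon> * (\<Sum>u \<in> pverts G. sqrt (real (out_degree G u)) * ppr G \<alpha> u t))) \<and>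
       measure_pmf.expectation (pmf_of_set (pverts G))
         (\<lambda>t. expected_cost G t \<alpha> (\<theta> n \<epsilon>) (sqrt_degree G) (K n))
       \<le> C * polylog k n \<epsilon> * (sqrt (real m / real n) / \<epsilon>))"
proof -
  \<comment> \<open>A suitable \<open>B\<close>, depending only on \<alpha> and \<open>c\<close>,
    exists because a linear function outgrows a logarithm.\<close>
  have "filterlim (\<lambda>B :: real. B / 2 - (2 + ln B) / (8 * (- ln (1 - \<alpha>)))) at_top at_top"
  proof -
    define \<beta> where "\<beta> = - ln (1 - \<alpha>)"
    have "0 < \<beta>"
      using assms by (simp add: \<beta>_def)
    then have "filterlim (\<lambda>B :: real. B / 2 - (2 + ln B) / (8 * \<beta>)) at_top at_top"
      by real_asymp
    then show ?thesis
      by (simp add: \<beta>_def)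
  qed
  then have "eventually (\<lambda>B :: real. c + 2 \<le> B / 2 - (2 + ln B) / (8 * (- ln (1 - \<alpha>)))) at_top"
    by (simp add: filterlim_at_top)
  then have "eventually (\<lambda>B :: real. c + 2 \<le> B / 2 - (2 + ln B) / (8 * (- ln (1 - \<alpha>))) \<and> 2 \<le> B) at_top"
    using eventually_ge_at_top by (rule eventually_conj)
  then obtain B :: real where B: "c + 2 \<le> B / 2 - (2 + ln B) / (8 * (- ln (1 - \<alpha>)))" and B2: "2 \<le> B"
    by (auto simp: eventually_at_top_linorder)
  define \<theta> where "\<theta> n \<epsilon> = \<epsilon> / (B * polylog 1 n \<epsilon>)" for n \<epsilon>
  \<comment> \<open>The division by \<alpha> matches the factor
    \<open>1 / (\<alpha> * \<theta>)\<close> of the cost bound.\<close>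
  define C where "C = B / \<alpha>"
  have CB: "B \<le> C"
    using assms B2 by (simp add: C_def field_simps)
  have \<theta>_bounds: "0 < \<theta> n \<epsilon>" "\<theta> n \<epsilon> < 1" "\<theta> n \<epsilon> \<le> \<epsilon> / 2"
    "\<epsilon> / (C * polylog 1 n \<epsilon>) \<le> \<theta> n \<epsilon>" "\<theta> n \<epsilon> \<le> C * polylog 1 n \<epsilon> * \<epsilon>"
    if "1 \<le> n" "0 < \<epsilon>" "\<epsilon> < 1" for n \<epsilon>
  proof -
    let ?P = "polylog 1 n \<epsilon>"
    have P: "1 \<le> ?P"
      using polylog_1_ge that by blast
    have BP: "2 * 1 \<le> B * ?P"
      using P B2 by (intro mult_mono) auto
    have CP: "B * ?P \<le> C * ?P"
      using P CB by (intro mult_right_mono) auto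
    show "0 < \<theta> n \<epsilon>"
      using that BP by (simp add: \<theta>_def)
    show half: "\<theta> n \<epsilon> \<le> \<epsilon> / 2"
      unfolding \<theta>_def using that BP by (intro divide_left_mono) auto
    show "\<theta> n \<epsilon> < 1"
      using half that by linarith
    show "\<epsilon> / (C * ?P) \<le> \<theta> n \<epsilon>"
      unfolding \<theta>_def using that BP CP P CB B2 by (intro divide_left_mono mult_pos_pos) auto
    have "1 * \<epsilon> \<le> C * ?P * \<epsilon>"
      using that BP CP by (intro mult_right_mono) auto
    then show "\<theta> n \<epsilon> \<le> C * ?P * \<epsilon>"
      using half that by linarith
  qed
  have cost: "expected_cost G t \<alpha> (\<theta> n \<epsilon>) (sqrt_degree G) 1
      \<le> C * polylog 1 n \<epsilon> * (1 / \<epsilon> * (\<Sum>u\<in>pverts G. sqrt (real (out_degree G u)) * ppr G \<alpha> u t))"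
    if "pair_fin_digraph G" "t \<in> pverts G" "1 \<le> n" "0 < \<epsilon>" "\<epsilon> < 1"
    for G :: "'a pair_pre_digraph" and t n \<epsilon>
  proof -
    interpret rbs_setup G t \<alpha> "\<theta> n \<epsilon>" "sqrt_degree G"
      using that assms \<theta>_bounds by (intro pair_fin_digraph.rbs_setup_sqrt_degree)
    show ?thesis
      using expected_cost_1_le by (simp add: sqrt_degree_def \<theta>_def C_def field_simps)
  qed
  have prob: "\<P>(\<omega> in rbs_draws G \<alpha> (\<theta> n \<epsilon>) 1. \<forall>s\<in>pverts G.
        \<bar>median_rbs G t \<alpha> (\<theta> n \<epsilon>) (sqrt_degree G) 1 \<omega> s - ppr G \<alpha> s t\<bar> \<le> \<epsilon>)
      \<ge> 1 - 1 / real n powr c"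
    if "pair_fin_digraph G" "t \<in> pverts G" "n = card (pverts G)" "1 \<le> n" "0 < \<epsilon>" "\<epsilon> < 1"
    for G :: "'a pair_pre_digraph" and t n \<epsilon>
  proof -
    let ?P = "\<lambda>a. \<P>(\<omega> in rbs_draws G \<alpha> (\<theta> n \<epsilon>) 1. \<forall>s\<in>pverts G.
        \<bar>median_rbs G t \<alpha> (\<theta> n \<epsilon>) (sqrt_degree G) 1 \<omega> s - ppr G \<alpha> s t\<bar> \<le> a)"
    interpret rbs_setup G t \<alpha> "\<theta> n \<epsilon>" "sqrt_degree G"
      using that assms \<theta>_bounds by (intro pair_fin_digraph.rbs_setup_sqrt_degree)
    have "1 - real n * (2 * exp (real (rbs_depth \<alpha> (\<theta> n \<epsilon>)) / 8 - (\<epsilon> - \<theta> n \<epsilon>) / \<theta> n \<epsilon>)) \<le> ?P \<epsilon>"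
      using prob_median_rbs_1[OF refl \<theta>_bounds(2)[OF that(4-6)], of "\<epsilon> - \<theta> n \<epsilon>"] that(3) by simp
    \<comment> \<open>Truncation uses up at most half of the error, so at least
      \<open>\<epsilon> / 2\<close> is left for the deviation.\<close>
    moreover have "(\<epsilon> / 2) / \<theta> n \<epsilon> \<le> (\<epsilon> - \<theta> n \<epsilon>) / \<theta> n \<epsilon>"
      using \<theta>_bounds[OF that(4-6)] by (intro divide_right_mono) auto
    then have "exp (real (rbs_depth \<alpha> (\<theta> n \<epsilon>)) / 8 - (\<epsilon> - \<theta> n \<epsilon>) / \<theta> n \<epsilon>)
        \<le> exp (real (rbs_depth \<alpha> (\<theta> n \<epsilon>)) / 8 - (\<epsilon> / 2) / \<theta> n \<epsilon>)"
      unfolding exp_le_cancel_iff by linarith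
    then have "real n * (2 * exp (real (rbs_depth \<alpha> (\<theta> n \<epsilon>)) / 8 - (\<epsilon> - \<theta> n \<epsilon>) / \<theta> n \<epsilon>))
        \<le> real n * (2 * exp (real (rbs_depth \<alpha> (\<theta> n \<epsilon>)) / 8 - (\<epsilon> / 2) / \<theta> n \<epsilon>))"
      by (intro mult_left_mono) auto
    moreover have "\<dots> \<le> 1 / real n powr c"
      unfolding \<theta>_def using assms that B B2 by (intro failure_probability_le)
    ultimately show ?thesis
      by linarith
  qed
  have avg: "measure_pmf.expectation (pmf_of_set (pverts G))
        (\<lambda>t. expected_cost G t \<alpha> (\<theta> n \<epsilon>) (sqrt_degree G) 1)
      \<le> C * polylog 1 n \<epsilon> * (sqrt (real m / real n) / \<epsilon>)"
    if G: "pair_fin_digraph G" "pverts G \<noteq> {}" "n = card (pverts G)" "m = card (parcs G)"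
      "1 \<le> n" "0 < \<epsilon>" "\<epsilon> < 1"
    for G :: "'a pair_pre_digraph" and n m \<epsilon>
  proof -
    interpret pair_fin_digraph G by fact
    define D where "D = C * polylog 1 n \<epsilon> / \<epsilon>"
    have D: "0 \<le> D"
      using polylog_1_ge[of n \<epsilon>] G CB B2 by (auto simp: D_def intro!: divide_nonneg_nonneg mult_nonneg_nonneg)
    have "(\<Sum>t\<in>pverts G. expected_cost G t \<alpha> (\<theta> n \<epsilon>) (sqrt_degree G) 1)
        \<le> (\<Sum>t\<in>pverts G. D * (\<Sum>u\<in>pverts G. sqrt (real (out_degree G u)) * ppr G \<alpha> u t))"
      using cost[OF G(1) _ G(5-7)] by (intro sum_mono) (simp add: D_def)
    also have "\<dots> = D * (\<Sum>u\<in>pverts G. sqrt (real (out_degree G u)) * (\<Sum>t\<in>pverts G. ppr G \<alpha> u t))"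
      unfolding sum_distrib_left[symmetric, of D] by (subst sum.swap) (simp only: sum_distrib_left)
    \<comment> \<open>Summed over all targets, the PPR from \<open>u\<close> is at most 1, which
      leaves only the degrees.\<close>
    also have "\<dots> \<le> D * (\<Sum>u\<in>pverts G. sqrt (real (out_degree G u)) * 1)"
      using D by (intro mult_left_mono sum_mono sum_ppr_le_1) auto
    finally have "(\<Sum>t\<in>pverts G. expected_cost G t \<alpha> (\<theta> n \<epsilon>) (sqrt_degree G) 1) / real n
        \<le> D * ((\<Sum>u\<in>pverts G. sqrt (real (out_degree G u))) / real n)"
      by (simp add: divide_right_mono)
    also have "\<dots> \<le> D * sqrt (real m / real n)"
      unfolding G(3,4) using D by (intro mult_left_mono sum_sqrt_out_degree_le)
    finally show ?thesis
      using G pair_finite_verts by (simp add: integral_pmf_of_set D_def mult_ac)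
  qed
  have "1 \<le> C"
    using CB B2 by simp
  show ?thesis
  \<comment> \<open>One copy and exponent 1 of the polylogarithm suffice.\<close>
  proof (rule exI[of _ \<theta>], rule exI[of _ "\<lambda>_. 1"], rule exI[of _ C], rule exI[of _ 1],
      intro conjI allI impI ballI)
    show "0 < C"
      using \<open>1 \<le> C\<close> by simp
    show "1 \<le> (1 :: nat)"
      by simp
    show "real 1 \<le> C * (1 + ln (real n))" if "1 \<le> n" for n
      using mult_mono[of 1 C 1 "1 + ln (real n)"] that \<open>1 \<le> C\<close> by simp
  next
    fix n :: nat and \<epsilon> :: real
    assume "1 \<le> n" "0 < \<epsilon> \<and> \<epsilon> < 1"
    then show "0 < \<theta> n \<epsilon>" "\<theta> n \<epsilon> < 1"
      "\<epsilon> / (C * polylog 1 n \<epsilon>) \<le> \<theta> n \<epsilon>" "\<theta> n \<epsilon> \<le> C * polylog 1 n \<epsilon> * \<epsilon>"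
      using \<theta>_bounds[of n \<epsilon>] by blast+
  next
    fix G :: "'a pair_pre_digraph" and n m :: nat and \<epsilon> :: real
    assume "pair_fin_digraph G \<and> pverts G \<noteq> {} \<and> n = card (pverts G) \<and> m = card (parcs G) \<and>
      0 < \<epsilon> \<and> \<epsilon> < 1"
    then have G: "pair_fin_digraph G" "pverts G \<noteq> {}" "n = card (pverts G)" "m = card (parcs G)"
      "0 < \<epsilon>" "\<epsilon> < 1"
      by blast+
    have n: "1 \<le> n"
      using G pair_fin_digraph.pair_finite_verts[OF G(1)] by (simp add: Suc_le_eq card_gt_0_iff)
    show "measure_pmf.expectation (pmf_of_set (pverts G))
        (\<lambda>t. expected_cost G t \<alpha> (\<theta> n \<epsilon>) (sqrt_degree G) 1)
      \<le> C * polylog 1 n \<epsilon> * (sqrt (real m / real n) / \<epsilon>)"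
      by (rule avg[OF G(1-4) n G(5,6)])
    fix t assume t: "t \<in> pverts G"
    show "1 - 1 / real n powr c \<le> \<P>(\<omega> in rbs_draws G \<alpha> (\<theta> n \<epsilon>) 1. \<forall>s\<in>pverts G.
        \<bar>median_rbs G t \<alpha> (\<theta> n \<epsilon>) (sqrt_degree G) 1 \<omega> s - ppr G \<alpha> s t\<bar> \<le> \<epsilon>)"
      by (rule prob[OF G(1) t G(3) n G(5,6)])
    show "expected_cost G t \<alpha> (\<theta> n \<epsilon>) (sqrt_degree G) 1
      \<le> C * polylog 1 n \<epsilon> * (1 / \<epsilon> * (\<Sum>u\<in>pverts G. sqrt (real (out_degree G u)) * ppr G \<alpha> u t))"
      by (rule cost[OF G(1) t n G(5,6)])
  qed
qed

end
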